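(* Let $G$ be a graph without universal vertices and let $\mathcal R'$ be a partial normal Helly circular-arc representation of $G$ such that $\mathrm{Reg}(C)\neq\emptyset$ for every maximal clique $C$ of $G$. Let $D$ be a maximal clique of $G$ whose region $\mathrm{Reg}(D)$ is connected (a single island), let $p_D$ be the middle point of $\mathrm{Reg}(D)$, and let $\prec$ be the partial order on the maximal cliques defined from $p_D$ as in the context. Then there exists a normal Helly circular-arc representation of $G$ extending $\mathcal R'$ if and only if there exists a linear extension $<$ of $\prec$ such that: (1) for any pair of distinct maximal cliques $C\neq C'$ with $\mathrm{Reg}(C)=\mathrm{Reg}(C')$, the region $\mathrm{Reg}(C)$ is not a single point; (2) for every vertex $v$, the set $M_v$ of maximal cliques containing $v$ is consecutive in the cyclic order $[<]$; (3) for every universal pair $u,w$, the set $M_u\cap M_w$ is consecutive in $[<]$; (4) for every gap $J$ of some maximal clique $C$, the set $S_J$ is consecutive in $[<]$.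
   Context: Circular-arc representations assign closed arcs $R(v)$ of a fixed circle to vertices, with $R(u)\cap R(v)\neq\emptyset$ iff $uv\in E(G)$; normal means any two arcs have empty or connected intersection; Helly means every family of pairwise intersecting arcs has a common point. A partial representation $\mathcal R'$ of $G$ is a representation (here normal Helly) of an induced subgraph $G'$ of $G$; it is extended by $\mathcal R$ if $R(u)=R'(u)$ for $u\in V(G')$. A vertex is universal if adjacent to all others; adjacent vertices $u,w$ form a universal pair if every vertex is adjacent to $u$ or to $w$. For a maximal clique $C$ let $\mathrm{Pre}(C)=\{R'(v): v\in C\cap V(G')\}$, $\mathrm{Reg}^+(C)=\bigcap_{R\in \mathrm{Pre}(C)}R$, $\mathrm{Reg}^-(C)=\bigcup_{R\in\mathcal R'\setminus\mathrm{Pre}(C)}R$, and $\mathrm{Reg}(C)=\mathrm{Reg}^+(C)\setminus\mathrm{Reg}^-(C)$. Connected components of $\mathrm{Reg}(C)$ are islands of $C$, connected components of the complement of $\mathrm{Reg}(C)$ are gaps of $C$. For a gap $J$, $S_J=\{C \text{ maximal clique}: \mathrm{Reg}(C)\cap J\neq\emptyset\}$. Let $\le$ be the linear order of the points of the circle obtained by traversing it clockwise starting at $p_D$. The partial order $\prec$ on maximal cliques: $D\prec C$ for every maximal clique $C\neq D$, and for $C,C'\neq D$, $C\prec C'$ whenever $p<q$ for all $p\in\mathrm{Reg}(C)$, $q\in\mathrm{Reg}(C')$. For a linear order $<$, $[<]$ denotes the cyclic order it induces; a set is consecutive in $[<]$ if it forms a contiguous block in some rotation of $<$. *)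

theory Defs
  imports "HOL-Analysis.Analysis" "HOL-Library.Ramsey"
begin

definition simple_graph :: "'a set \<Rightarrow> 'a set set \<Rightarrow> bool" where
  "simple_graph V E \<longleftrightarrow> finite V \<and> (\<forall>e\<in>E. e \<subseteq> V \<and> card e = 2)"

definition max_cliques :: "'a set \<Rightarrow> 'a set set \<Rightarrow> 'a set set" where
  "max_cliques V E =
     {C. C \<subseteq> V \<and> clique C E \<and> (\<forall>K. K \<subseteq> V \<and> clique K E \<and> C \<subseteq> K \<longrightarrow> K = C)}"

definition cliques_containing :: "'a set \<Rightarrow> 'a set set \<Rightarrow> 'a \<Rightarrow> 'a set set" where
  "cliques_containing V E v = {C \<in> max_cliques V E. v \<in> C}"

definition universal_vertex :: "'a set \<Rightarrow> 'a set set \<Rightarrow> 'a \<Rightarrow> bool" where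
  "universal_vertex V E v \<longleftrightarrow> v \<in> V \<and> (\<forall>u\<in>V. u \<noteq> v \<longrightarrow> {u, v} \<in> E)"

definition universal_pair :: "'a set \<Rightarrow> 'a set set \<Rightarrow> 'a \<Rightarrow> 'a \<Rightarrow> bool" where
  "universal_pair V E u w \<longleftrightarrow>
     u \<in> V \<and> w \<in> V \<and> {u, w} \<in> E \<and> (\<forall>x\<in>V. {x, u} \<in> E \<or> {x, w} \<in> E)"

abbreviation circle :: "complex set" where
  "circle \<equiv> sphere 0 1"

text \<open>Single points (\<open>a = b\<close>) and the whole circle (\<open>b - a \<ge> 2 * pi\<close>) count as closed arcs;
  the empty set does not.\<close>

definition closed_arc :: "complex set \<Rightarrow> bool" where
  "closed_arc A \<longleftrightarrow> (\<exists>a b. a \<le> b \<and> A = cis ` {a..b})"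

text \<open>Adjacency is only inspected between elements of the given vertex set, so for \<open>V' \<subseteq> V\<close> the pair \<open>V'\<close>, \<open>E\<close>
  also describes the subgraph induced by \<open>V'\<close>.\<close>

definition circular_arc_rep :: "'a set \<Rightarrow> 'a set set \<Rightarrow> ('a \<Rightarrow> complex set) \<Rightarrow> bool" where
  "circular_arc_rep V E R \<longleftrightarrow>
     (\<forall>v\<in>V. closed_arc (R v)) \<and>
     (\<forall>u\<in>V. \<forall>v\<in>V. u \<noteq> v \<longrightarrow> (R u \<inter> R v \<noteq> {} \<longleftrightarrow> {u, v} \<in> E))"

definition normal_rep :: "'a set \<Rightarrow> ('a \<Rightarrow> complex set) \<Rightarrow> bool" where
  "normal_rep V R \<longleftrightarrow> (\<forall>u\<in>V. \<forall>v\<in>V. R u \<inter> R v = {} \<or> connected (R u \<inter> R v))"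

definition helly_rep :: "'a set \<Rightarrow> ('a \<Rightarrow> complex set) \<Rightarrow> bool" where
  "helly_rep V R \<longleftrightarrow>
     (\<forall>S\<subseteq>V. (\<forall>u\<in>S. \<forall>v\<in>S. R u \<inter> R v \<noteq> {}) \<longrightarrow> (\<Inter>v\<in>S. R v) \<noteq> {})"

definition nhca_rep :: "'a set \<Rightarrow> 'a set set \<Rightarrow> ('a \<Rightarrow> complex set) \<Rightarrow> bool" where
  "nhca_rep V E R \<longleftrightarrow> circular_arc_rep V E R \<and> normal_rep V R \<and> helly_rep V R"

definition partial_nhca_rep ::
    "'a set \<Rightarrow> 'a set set \<Rightarrow> 'a set \<Rightarrow> ('a \<Rightarrow> complex set) \<Rightarrow> bool" where
  "partial_nhca_rep V E V' R' \<longleftrightarrow> V' \<subseteq> V \<and> nhca_rep V' E R'"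

definition extends_rep :: "'a set \<Rightarrow> ('a \<Rightarrow> complex set) \<Rightarrow> ('a \<Rightarrow> complex set) \<Rightarrow> bool" where
  "extends_rep V' R' R \<longleftrightarrow> (\<forall>u\<in>V'. R u = R' u)"

text \<open>A representation is a family indexed by vertices: a pre-drawn vertex outside \<open>C\<close> contributes
  to \<open>Reg_minus\<close> even if its arc coincides, as a set of points, with the arc of a vertex in \<open>C\<close>.
  If no vertex of \<open>C\<close> is pre-drawn, the empty intersection \<open>Reg_plus\<close> is the whole circle.\<close>

definition Reg_plus :: "'a set \<Rightarrow> ('a \<Rightarrow> complex set) \<Rightarrow> 'a set \<Rightarrow> complex set" where
  "Reg_plus V' R' C = circle \<inter> (\<Inter>v\<in>C \<inter> V'. R' v)"

definition Reg_minus :: "'a set \<Rightarrow> ('a \<Rightarrow> complex set) \<Rightarrow> 'a set \<Rightarrow> complex set" where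
  "Reg_minus V' R' C = (\<Union>v\<in>V' - C. R' v)"

definition Reg :: "'a set \<Rightarrow> ('a \<Rightarrow> complex set) \<Rightarrow> 'a set \<Rightarrow> complex set" where
  "Reg V' R' C = Reg_plus V' R' C - Reg_minus V' R' C"

definition gaps :: "'a set \<Rightarrow> ('a \<Rightarrow> complex set) \<Rightarrow> 'a set \<Rightarrow> complex set set" where
  "gaps V' R' C = components (circle - Reg V' R' C)"

definition cliques_meeting ::
    "'a set \<Rightarrow> 'a set set \<Rightarrow> 'a set \<Rightarrow> ('a \<Rightarrow> complex set) \<Rightarrow> complex set \<Rightarrow> 'a set set" where
  "cliques_meeting V E V' R' J = {C \<in> max_cliques V E. Reg V' R' C \<inter> J \<noteq> {}}"

text \<open>\<open>A\<close> is a possibly half-open arc with end points at angles \<open>a\<close> and \<open>b\<close>, and \<open>p\<close> lies halfway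
  between them. The middle point is unique, except that every point of the full circle is a
  middle point of it.\<close>

definition middle_point :: "complex \<Rightarrow> complex set \<Rightarrow> bool" where
  "middle_point p A \<longleftrightarrow> p \<in> A \<and>
     (\<exists>a b. a \<le> b \<and> b \<le> a + 2 * pi \<and> cis ` {a<..<b} \<subseteq> A \<and> A \<subseteq> cis ` {a..b} \<and>
            p = cis ((a + b) / 2))"

text \<open>On the circle, \<open>Arg2pi (p / x)\<close> is the angle in \<open>[0, 2 * pi)\<close> travelled clockwise from \<open>p\<close>
  to \<open>x\<close>.\<close>

definition clockwise_less :: "complex \<Rightarrow> complex \<Rightarrow> complex \<Rightarrow> bool" where
  "clockwise_less p x y \<longleftrightarrow> Arg2pi (p / x) < Arg2pi (p / y)"

definition clique_prec ::
    "'a set \<Rightarrow> 'a set set \<Rightarrow> 'a set \<Rightarrow> ('a \<Rightarrow> complex set) \<Rightarrow> 'a set \<Rightarrow> complex \<Rightarrow> 'a set rel" where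
  "clique_prec V E V' R' D p =
     {(C, C') \<in> max_cliques V E \<times> max_cliques V E.
        (C = D \<and> C' \<noteq> D) \<or>
        (C \<noteq> D \<and> C' \<noteq> D \<and> (\<forall>x\<in>Reg V' R' C. \<forall>y\<in>Reg V' R' C'. clockwise_less p x y))}"

definition linear_extension :: "'b set \<Rightarrow> 'b rel \<Rightarrow> 'b rel \<Rightarrow> bool" where
  "linear_extension M P r \<longleftrightarrow> r \<subseteq> M \<times> M \<and> strict_linear_order_on M r \<and> P \<subseteq> r"

text \<open>The rotation of a strict linear order on \<open>M\<close> that moves the initial segment \<open>I\<close> to the end.\<close>

definition rotation :: "'b set \<Rightarrow> 'b rel \<Rightarrow> 'b set \<Rightarrow> 'b rel" where
  "rotation M r I = {(x, y) \<in> r. x \<in> I \<longleftrightarrow> y \<in> I} \<union> (M - I) \<times> I"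

text \<open>The cyclic order induced by \<open>r\<close>, represented as the class of all rotations of \<open>r\<close>.\<close>

definition cyclic_order :: "'b set \<Rightarrow> 'b rel \<Rightarrow> 'b rel set" where
  "cyclic_order M r = {rotation M r I | I. I \<subseteq> M \<and> (\<forall>x\<in>I. \<forall>y. (y, x) \<in> r \<longrightarrow> y \<in> I)}"

definition contiguous :: "'b set \<Rightarrow> 'b rel \<Rightarrow> 'b set \<Rightarrow> bool" where
  "contiguous M r S \<longleftrightarrow>
     S \<subseteq> M \<and> (\<forall>x\<in>S. \<forall>z\<in>S. \<forall>y\<in>M. (x, y) \<in> r \<and> (y, z) \<in> r \<longrightarrow> y \<in> S)"

definition consecutive :: "'b set \<Rightarrow> 'b rel set \<Rightarrow> 'b set \<Rightarrow> bool" where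
  "consecutive M Q S \<longleftrightarrow> (\<exists>r\<in>Q. contiguous M r S)"

end

theory Submission
  imports Defs
begin

text \<open>Regions of maximal cliques are either equal or disjoint. A connected subset of the circle that
  avoids the two ends of an arc lies inside the arc or outside it; this fact replaces all case
  distinctions about circular intervals. It implies that a region which meets a gap of a clique is
  contained in that gap.

  Given a representation, the Helly property yields a point for each maximal clique, and the
  clockwise order of these points starting at the point of \<open>D\<close> satisfies all conditions.
  Starting at \<open>p\<^sub>D\<close> instead only changes the position of cliques whose region is \<open>Reg D\<close>, and
  these are incomparable to the rest because \<open>p\<^sub>D\<close> is an interior point of \<open>Reg D\<close> as soon as
  there is such a clique other than \<open>D\<close>.

  Conversely, clique points are placed greedily in the given order, each in the first possible
  island. If there is no island left for \<open>C\<close>, then some earlier \<open>K\<close> was the first to be placed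
  after all islands of \<open>C\<close>, and the predecessor \<open>L\<close> of \<open>K\<close> lies with an island of \<open>C\<close> in one gap
  \<open>J\<close> of \<open>K\<close>. Since \<open>L < K < C\<close> and \<open>S\<^sub>J\<close> is consecutive, \<open>D \<in> S\<^sub>J\<close>, so \<open>p\<^sub>D \<in> J\<close>, which is
  impossible because \<open>J\<close> is enclosed by two points of \<open>Reg K\<close>. A vertex that is not pre-drawn then
  gets the arc spanned by its clique points.\<close>

subsection \<open>Arcs and connected subsets of the circle\<close>

lemma cis_eqD:
  assumes "cis a = cis b" "\<bar>a - b\<bar> < 2 * pi"
  shows "a = b"
proof -
  have "sin a = sin b \<and> cos a = cos b"
    using assms(1) by (simp add: complex_eq_iff)
  then obtain n :: int where n: "a = b + 2 * pi * n"
    using sin_cos_eq_iff by blast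
  then have "\<bar>real_of_int n\<bar> < 1"
    using assms(2) by (simp add: abs_mult)
  then have "n = 0"
    by linarith
  then show ?thesis
    using n by simp
qed

lemma ex_cis_in_window:
  assumes "x \<in> circle"
  obtains t where "c \<le> t" "t < c + 2 * pi" "x = cis t"
proof -
  define s where "s = Arg2pi (x / cis c)"
  have "cmod (x / cis c) = 1"
    using assms by (simp add: norm_divide)
  then have "cis s = x / cis c"
    unfolding s_def using complex_norm_eq_1_exp cis_conv_exp by metis
  then have "x = cis (c + s)"
    by (simp flip: cis_mult)
  moreover have "0 \<le> s" "s < 2 * pi"
    using Arg2pi unfolding s_def by auto
  ultimately show thesis
    using that[of "c + s"] by auto
qed

lemma cis_image_full:
  assumes "a + 2 * pi \<le> b"
  shows "cis ` {a..b} = circle"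
proof -
  have "x \<in> cis ` {a..b}" if "x \<in> circle" for x
    using ex_cis_in_window[OF that, of a] assms by force
  then show ?thesis
    by auto
qed

lemma connected_cis_image: "connected S \<Longrightarrow> connected (cis ` S)"
  by (intro connected_continuous_image continuous_intros)

lemma closed_cis_image: "closed (cis ` {a..b})"
  by (intro compact_imp_closed compact_continuous_image continuous_intros compact_Icc)

lemma arc_Int_opposite_arc:
  assumes "a \<le> b" "b < a + 2 * pi"
  shows "cis ` {a..b} \<inter> cis ` {b..a + 2 * pi} \<subseteq> {cis a, cis b}"
proof
  fix x assume "x \<in> cis ` {a..b} \<inter> cis ` {b..a + 2 * pi}"
  then obtain s t where st: "a \<le> s" "s \<le> b" "b \<le> t" "t \<le> a + 2 * pi" "x = cis s" "x = cis t"
    by auto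
  have "s = t \<or> t - s = 2 * pi"
    proof (cases "t - s = 2 * pi")
    case False
    then have "\<bar>s - t\<bar> < 2 * pi"
      using st by linarith
    then show ?thesis
      using cis_eqD[of s t] st by simp
  qed simp
  then show "x \<in> {cis a, cis b}"
  proof
    assume "s = t"
    then have "s = b" using st by simp
    then show ?thesis using st by simp
  next
    assume "t - s = 2 * pi"
    then have "s = a" using st by simp
    then show ?thesis using st by simp
  qed
qed

lemma arc_Un_opposite_arc:
  assumes "a \<le> b" "b < a + 2 * pi"
  shows "cis ` {a..b} \<union> cis ` {b..a + 2 * pi} = circle"
proof -
  have "{a..b} \<union> {b..a + 2 * pi} = {a..a + 2 * pi}"
    using assms by auto
  then show ?thesis
    by (metis cis_image_full image_Un order_refl)
qed

text \<open>The arc and its closed opposite arc cover the circle and share only their two ends, so a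
  connected set avoiding these ends cannot meet both. An arc of length at least
  \<open>2 * pi\<close> is the whole circle.\<close>

lemma connected_avoiding_arc_ends:
  assumes "a \<le> b" "connected S" "S \<subseteq> circle" "cis a \<notin> S" "cis b \<notin> S"
  shows "S \<subseteq> cis ` {a..b} \<or> S \<inter> cis ` {a..b} = {}"
proof (cases "b < a + 2 * pi")
  case True
  define A where "A = cis ` {a..b}"
  define B where "B = cis ` {b..a + 2 * pi}"
  have AB: "A \<inter> B \<subseteq> {cis a, cis b}" "A \<union> B = circle"
    using arc_Int_opposite_arc[OF assms(1) True] arc_Un_opposite_arc[OF assms(1) True]
    unfolding A_def B_def .
  have "A \<inter> S = {} \<or> B \<inter> S = {}"
  proof (rule connected_closedD[OF assms(2)])
    show "closed A" "closed B"
      unfolding A_def B_def by (rule closed_cis_image)+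
  qed (use AB assms(3-5) in blast)+
  then have "S \<subseteq> A \<or> S \<inter> A = {}"
    using AB(2) assms(3) by blast
  then show ?thesis
    unfolding A_def .
next
  case False
  then show ?thesis
    using cis_image_full[of a b] assms(3) by simp
qed

lemma closed_arcD:
  assumes "closed_arc A"
  shows "A \<subseteq> circle" "closed A" "connected A" "A \<noteq> {}"
  using assms closed_cis_image connected_cis_image[OF connected_Icc] by (auto simp: closed_arc_def)

text \<open>Two points outside \<open>A\<close> bound two arcs that share no other points. Being
  connected and avoiding both points, \<open>A\<close> misses one of these arcs, which then joins
  the two points outside \<open>A\<close>.\<close>

lemma connected_circle_Diff:
  assumes "connected A" "A \<subseteq> circle"
  shows "connected (circle - A)"
  unfolding connected_iff_connected_component
proof (intro ballI)
  fix x y assume xy: "x \<in> circle - A" "y \<in> circle - A"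
  obtain a where a: "x = cis a"
    using ex_cis_in_window[of x] xy by blast
  obtain b where b: "a \<le> b" "b < a + 2 * pi" "y = cis b"
    using ex_cis_in_window[of y a] xy by blast
  have a': "x = cis (a + 2 * pi)"
    using a by (simp flip: cis_mult)
  define S where "S = cis ` {a..b}"
  define T where "T = cis ` {b..a + 2 * pi}"
  have S: "connected S" "S \<subseteq> circle" "x \<in> S" "y \<in> S"
    unfolding S_def using a b by (auto intro!: connected_cis_image)
  have T: "connected T" "T \<subseteq> circle" "x \<in> T" "y \<in> T"
    unfolding T_def using a' b by (auto intro!: connected_cis_image)
  have "S \<inter> T \<subseteq> {x, y}"
    unfolding S_def T_def a b(3) using arc_Int_opposite_arc[OF b(1,2)] .
  moreover have "A \<subseteq> S \<or> A \<inter> S = {}"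
    unfolding S_def using connected_avoiding_arc_ends[OF b(1) assms] xy a b by simp
  ultimately have "S \<subseteq> circle - A \<or> T \<subseteq> circle - A"
    using S(2) T(2) xy by blast
  then show "connected_component (circle - A) x y"
    unfolding connected_component_def using S T by blast
qed

text \<open>De Morgan: the complements of \<open>A\<close> and \<open>B\<close> are connected and
  share a point, so their union is connected, and hence so is the complement of this union.\<close>

lemma connected_Int_if_Un_ne_circle:
  assumes "connected A" "connected B" "A \<subseteq> circle" "B \<subseteq> circle" "A \<union> B \<noteq> circle"
  shows "connected (A \<inter> B)"
proof -
  have "connected ((circle - A) \<union> (circle - B))"
    using assms by (intro connected_Un connected_circle_Diff) auto
  then have "connected (circle - ((circle - A) \<union> (circle - B)))"
    by (rule connected_circle_Diff) auto
  moreover have "circle - ((circle - A) \<union> (circle - B)) = A \<inter> B"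
    using assms by auto
  ultimately show ?thesis by simp
qed

text \<open>The complement of \<open>A\<close> is connected and avoids both ends of the arc. As it
  contains \<open>y\<close>, which is off the arc, it misses the arc altogether.\<close>

lemma arc_subset_connected:
  assumes "a \<le> b" "connected A" "A \<subseteq> circle" "cis a \<in> A" "cis b \<in> A"
    and "y \<in> circle - A" "y \<notin> cis ` {a..b}"
  shows "cis ` {a..b} \<subseteq> A"
proof -
  have "circle - A \<subseteq> cis ` {a..b} \<or> (circle - A) \<inter> cis ` {a..b} = {}"
    using assms by (intro connected_avoiding_arc_ends connected_circle_Diff) auto
  then have "(circle - A) \<inter> cis ` {a..b} = {}"
    using assms(6,7) by blast
  moreover have "cis ` {a..b} \<subseteq> circle" by auto
  ultimately show ?thesis by blast
qed

text \<open>\<open>B\<close> contains the open opposite arc and, being closed, also the ends of that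
  arc, which are the ends of the given one.\<close>

lemma arc_ends_in_closed_cover:
  assumes "a \<le> b" "cis ` {a..b} \<noteq> circle" "closed B" "circle \<subseteq> cis ` {a..b} \<union> B"
  shows "cis a \<in> B" "cis b \<in> B"
proof -
  have b: "b < a + 2 * pi"
    using cis_image_full[of a b] assms(2) by linarith
  have sub: "cis ` {b<..<a + 2 * pi} \<subseteq> B"
  proof
    fix x assume "x \<in> cis ` {b<..<a + 2 * pi}"
    then obtain t where t: "b < t" "t < a + 2 * pi" "x = cis t" by auto
    have "x \<notin> cis ` {a..b}"
    proof
      assume "x \<in> cis ` {a..b}"
      then obtain s where s: "a \<le> s" "s \<le> b" "cis s = cis t" using t by auto
      then have "s = t" using cis_eqD[of s t] t by (auto simp: abs_real_def)
      then show False using s t by simp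
    qed
    moreover have "x \<in> circle" using t(3) by simp
    ultimately show "x \<in> B" using assms(4) by blast
  qed
  have "cis ` closure {b<..<a + 2 * pi} \<subseteq> closure (cis ` {b<..<a + 2 * pi})"
    by (intro image_closure_subset continuous_intros closure_subset) simp
  also have "\<dots> \<subseteq> B"
    using sub assms(3) by (rule closure_minimal)
  finally have "cis ` {b..a + 2 * pi} \<subseteq> B"
    using b by simp
  moreover have "cis a = cis (a + 2 * pi)" by (simp flip: cis_mult)
  ultimately show "cis a \<in> B" "cis b \<in> B"
    using b by auto
qed

section \<open>Clockwise parameters on the circle\<close>

text \<open>Parametrises the circle clockwise from \<open>cis c\<close>, so that larger parameters
  mean later positions. On the circle, \<open>Arg2pi (cis c / x)\<close> is the inverse with values
  in \<open>{0..<2 * pi}\<close>.\<close>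

definition cw :: "real \<Rightarrow> real \<Rightarrow> complex" where
  "cw c t = cis (c - t)"

lemma cw_in_circle [simp]: "cw c t \<in> circle" and norm_cw [simp]: "cmod (cw c t) = 1"
  by (simp_all add: cw_def)

lemma cw_periodic [simp]: "cw c (t + 2 * pi) = cw c t" "cw c (t - 2 * pi) = cw c t"
  by (simp_all add: cw_def complex_eq_iff cos_diff cos_add sin_diff sin_add)

lemma cw_image: "cw c ` {a..b} = cis ` {c - b..c - a}"
proof -
  have "(\<lambda>t. c - t) ` {a..b} = {c - b..c - a}" by simp
  then show ?thesis
    unfolding cw_def by (metis image_image)
qed

lemma cw_eqD: "cw c s = cw c t \<Longrightarrow> \<bar>s - t\<bar> < 2 * pi \<Longrightarrow> s = t"
  using cis_eqD[of "c - s" "c - t"] by (auto simp: cw_def)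

lemma continuous_on_cw: "continuous_on S (cw c)"
  unfolding cw_def by (intro continuous_intros)

lemma connected_cw_image: "connected S \<Longrightarrow> connected (cw c ` S)"
  by (intro connected_continuous_image continuous_on_cw)

text \<open>The map \<open>cw c\<close> is injective on a half-open window of length
  \<open>2 * pi\<close>. The free start \<open>w\<close> admits parameters that have been shifted by
  a full turn.\<close>

lemma cw_mem_arc_iff:
  assumes "w \<le> a" "b < w + 2 * pi" "w \<le> t" "t < w + 2 * pi"
  shows "cw c t \<in> cw c ` {a..b} \<longleftrightarrow> a \<le> t \<and> t \<le> b"
proof
  assume "cw c t \<in> cw c ` {a..b}"
  then obtain s where "a \<le> s" "s \<le> b" "cw c t = cw c s" by auto
  moreover from this have "t = s" using cw_eqD[of c t s] assms by (auto simp: abs_real_def)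
  ultimately show "a \<le> t \<and> t \<le> b" by simp
qed auto

lemma connected_avoiding_cw_ends:
  assumes "a \<le> b" "connected S" "S \<subseteq> circle" "cw c a \<notin> S" "cw c b \<notin> S"
  shows "S \<subseteq> cw c ` {a..b} \<or> S \<inter> cw c ` {a..b} = {}"
  unfolding cw_image using assms by (intro connected_avoiding_arc_ends) (auto simp: cw_def)

lemma angle_range: "0 \<le> Arg2pi x" "Arg2pi x < 2 * pi"
  using Arg2pi by auto

lemma cw_angle:
  assumes "x \<in> circle"
  shows "cw c (Arg2pi (cis c / x)) = x"
proof -
  have "cmod (cis c / x) = 1" and "x \<noteq> 0"
    using assms by (auto simp: norm_divide)
  then have "cis (Arg2pi (cis c / x)) = cis c / x"
    using complex_norm_eq_1_exp cis_conv_exp by metis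
  then show ?thesis
    using \<open>x \<noteq> 0\<close> by (simp add: cw_def flip: cis_divide)
qed

lemma angle_cw:
  assumes "0 \<le> t" "t < 2 * pi"
  shows "Arg2pi (cis c / cw c t) = t"
proof (rule Arg2pi_unique[of 1])
  have "cis c / cw c t = cis t"
    by (simp add: cw_def flip: cis_divide)
  then show "of_real 1 * exp (\<i> * of_real t) = cis c / cw c t"
    by (simp add: cis_conv_exp)
qed (use assms in auto)

lemma cw_angle_eq:
  assumes "x \<in> circle" "y \<in> circle" "Arg2pi (cis c / x) = Arg2pi (cis c / y)"
  shows "x = y"
  using assms cw_angle by metis

subsection \<open>Maximal cliques and cyclic orders\<close>

lemma clique_in_max_clique:
  assumes "simple_graph V E" "K \<subseteq> V" "clique K E"
  obtains C where "C \<in> max_cliques V E" "K \<subseteq> C"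
proof -
  let ?F = "{K. K \<subseteq> V \<and> clique K E}"
  have "finite ?F"
    using assms(1) by (auto simp: simple_graph_def)
  moreover have "K \<in> ?F"
    using assms by simp
  ultimately obtain C where "C \<in> ?F" "K \<subseteq> C" "\<forall>B\<in>?F. C \<subseteq> B \<longrightarrow> C = B"
    by (rule finite_has_maximal2[elim_format]) blast
  then show thesis
    by (intro that[of C]) (auto simp: max_cliques_def)
qed

lemma max_cliqueD:
  assumes "C \<in> max_cliques V E"
  shows "C \<subseteq> V" "clique C E"
  using assms by (auto simp: max_cliques_def)

lemma max_clique_subset_eq:
  assumes "C \<in> max_cliques V E" "C' \<in> max_cliques V E" "C \<subseteq> C'"
  shows "C = C'"
  using assms by (auto simp: max_cliques_def)

lemma finite_max_cliques: "simple_graph V E \<Longrightarrow> finite (max_cliques V E)"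
  by (rule finite_subset[of _ "Pow V"]) (auto simp: max_cliques_def simple_graph_def)

lemma vertex_in_max_clique:
  assumes "simple_graph V E" "v \<in> V"
  obtains C where "C \<in> max_cliques V E" "v \<in> C"
  using clique_in_max_clique[OF assms(1), of "{v}"] assms(2) by (auto simp: clique_def)

lemma edge_iff_common_max_clique:
  assumes "simple_graph V E" "u \<in> V" "v \<in> V" "u \<noteq> v"
  shows "{u, v} \<in> E \<longleftrightarrow> (\<exists>C\<in>max_cliques V E. u \<in> C \<and> v \<in> C)"
proof
  assume "{u, v} \<in> E"
  then have "clique {u, v} E"
    by (auto simp: clique_def insert_commute)
  then show "\<exists>C\<in>max_cliques V E. u \<in> C \<and> v \<in> C"
    using clique_in_max_clique[OF assms(1), of "{u, v}"] assms by auto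
next
  assume "\<exists>C\<in>max_cliques V E. u \<in> C \<and> v \<in> C"
  then show "{u, v} \<in> E"
    using max_cliqueD(2) assms(4) unfolding clique_def by blast
qed

lemma max_clique_avoiding_vertex:
  assumes "simple_graph V E" "v \<in> V" "\<not> universal_vertex V E v"
  obtains C where "C \<in> max_cliques V E" "v \<notin> C"
proof -
  obtain u where u: "u \<in> V" "u \<noteq> v" "{u, v} \<notin> E"
    using assms(2,3) by (auto simp: universal_vertex_def)
  obtain C where C: "C \<in> max_cliques V E" "u \<in> C"
    using vertex_in_max_clique[OF assms(1) u(1)] .
  then have "v \<notin> C"
    using edge_iff_common_max_clique[OF assms(1) u(1) assms(2) u(2)] u(3) by blast
  then show thesis
    using that C(1) by blast
qed

text \<open>A maximal clique through \<open>x\<close> contains \<open>u\<close> or \<open>w\<close>,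
  which makes \<open>x\<close> adjacent to that vertex; for \<open>x = u\<close> or
  \<open>x = w\<close> the edge \<open>{u, w}\<close> itself serves.\<close>

lemma universal_pair_if_cover:
  assumes "simple_graph V E" "u \<in> V" "w \<in> V" "{u, w} \<in> E"
    and "\<forall>C\<in>max_cliques V E. u \<in> C \<or> w \<in> C"
  shows "universal_pair V E u w"
  unfolding universal_pair_def
proof (intro conjI ballI)
  fix x assume x: "x \<in> V"
  obtain C where C: "C \<in> max_cliques V E" "x \<in> C"
    using vertex_in_max_clique[OF assms(1) x] .
  have *: "{x, y} \<in> E" if "y \<in> C" "y \<in> V" "x \<noteq> y" for y
    using edge_iff_common_max_clique[OF assms(1) x that(2,3)] that(1) C by blast
  consider "x = u" | "x = w" | "x \<noteq> u" "x \<noteq> w" by blast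
  then show "{x, u} \<in> E \<or> {x, w} \<in> E"
    by cases (use assms(2-5) C(1) * in \<open>auto simp: insert_commute\<close>)
qed (use assms in auto)

section \<open>Consecutive sets of cliques and connected sets of points\<close>

text \<open>In a rotation where \<open>S\<close> is contiguous, \<open>C2\<close> cannot stay
  between \<open>C1\<close> and \<open>C3\<close>. So the cut falls after \<open>C1\<close> and at
  or before \<open>C3\<close>; everything up to \<open>C1\<close> moves behind \<open>C3\<close> and
  is enclosed by \<open>C3\<close> and \<open>C1\<close>.\<close>

lemma consecutive_wraps_around:
  assumes "consecutive M (cyclic_order M r) S" "trans r" "r \<subseteq> M \<times> M"
    and "(C1, C2) \<in> r" "(C2, C3) \<in> r" "C1 \<in> S" "C3 \<in> S" "C2 \<notin> S"
    and "B = C1 \<or> (B, C1) \<in> r"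
  shows "B \<in> S"
proof -
  obtain I where I: "I \<subseteq> M" "\<forall>x\<in>I. \<forall>y. (y, x) \<in> r \<longrightarrow> y \<in> I"
    and S: "contiguous M (rotation M r I) S"
    using assms(1) by (auto simp: consecutive_def cyclic_order_def)
  let ?r = "rotation M r I"
  have M: "C1 \<in> M" "C2 \<in> M" "C3 \<in> M" "B \<in> M"
    using assms(3,4,5,9) by auto
  have no: "\<not> ((C1, C2) \<in> ?r \<and> (C2, C3) \<in> ?r)"
    using S assms(6-8) M(2) unfolding contiguous_def by blast
  have mem: "C1 \<in> I \<or> C2 \<notin> I" "C2 \<in> I \<or> C3 \<notin> I"
    using I(2) assms(4,5) by auto
  have C3: "C3 \<notin> I" and C1: "C1 \<in> I"
    using no mem assms(4,5) by (auto simp: rotation_def)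
  have "B \<in> I"
    using C1 I(2) assms(9) by auto
  then have "(C3, B) \<in> ?r"
    using C3 M by (simp add: rotation_def)
  moreover have "B = C1 \<or> (B, C1) \<in> ?r"
    using assms(9) \<open>B \<in> I\<close> C1 by (auto simp: rotation_def)
  ultimately show ?thesis
    using S assms(6,7) M(4) unfolding contiguous_def by blast
qed

text \<open>Unless \<open>A\<close> is the whole circle, cut the circle at a point \<open>z\<close>
  outside \<open>A\<close>. If \<open>pt C2\<close> were outside \<open>A\<close> with
  \<open>C2\<close> between \<open>C1\<close> and \<open>C3\<close> after the cut, an arc with ends
  \<open>z\<close> and \<open>pt C2\<close> would contain exactly one of \<open>pt C1\<close> and
  \<open>pt C3\<close>, although \<open>A\<close> avoids both ends and is connected.\<close>

lemma consecutive_connected: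
  assumes "\<forall>C\<in>M. pt C \<in> circle" "connected A" "A \<subseteq> circle"
    and r: "r = {(C, C') \<in> M \<times> M. Arg2pi (cis c / pt C) < Arg2pi (cis c / pt C')}"
  shows "consecutive M (cyclic_order M r) {C \<in> M. pt C \<in> A}" (is "consecutive M _ ?S")
proof (cases "A = circle")
  case True
  then have "?S = M"
    using assms(1) by auto
  moreover have "rotation M r {} \<in> cyclic_order M r"
    by (auto simp: cyclic_order_def)
  ultimately show ?thesis
    unfolding consecutive_def contiguous_def by auto
next
  case False
  then obtain z where z: "z \<in> circle" "z \<notin> A"
    using assms(3) by blast
  define ang where "ang x = Arg2pi (cis c / x)" for x
  have cw: "cw c (ang x) = x" if "x \<in> circle" for x
    using cw_angle[OF that] by (simp add: ang_def)
  have range: "0 \<le> ang x" "ang x < 2 * pi" for x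
    using angle_range by (auto simp: ang_def)
  have arc: "x \<in> cw c ` {s..t} \<longleftrightarrow> s \<le> ang x \<and> ang x \<le> t"
    if "x \<in> circle" "0 \<le> s" "t < 2 * pi" for x s t
    using cw_mem_arc_iff[of 0 s t "ang x" c] that range[of x] cw[of x] by simp
  define I where "I = {C \<in> M. ang (pt C) < ang z}"
  have rI: "r = {(C, C') \<in> M \<times> M. ang (pt C) < ang (pt C')}"
    using r by (simp add: ang_def)
  have "contiguous M (rotation M r I) ?S"
    unfolding contiguous_def
  proof (intro conjI ballI impI)
    fix C1 C3 C2 assume C1: "C1 \<in> ?S" and C3: "C3 \<in> ?S" and C2: "C2 \<in> M"
      and rr: "(C1, C2) \<in> rotation M r I \<and> (C2, C3) \<in> rotation M r I"
    show "C2 \<in> ?S"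
    proof (rule ccontr)
      assume "C2 \<notin> ?S"
      then have C2A: "pt C2 \<notin> A" and C2c: "pt C2 \<in> circle"
        using C2 assms(1) by auto
      have c: "pt C1 \<in> circle" "pt C3 \<in> circle"
        using C1 C3 assms(1) by auto
      have ne: "ang (pt C1) \<noteq> ang z" "ang (pt C3) \<noteq> ang z"
        using C1 C3 z c cw by (metis (mono_tags, lifting) mem_Collect_eq)+
      show False
      proof (cases "ang z \<le> ang (pt C2)")
        case True
        let ?A = "cw c ` {ang z..ang (pt C2)}"
        have "A \<subseteq> ?A \<or> A \<inter> ?A = {}"
          using True assms(2,3) z C2A cw[OF z(1)] cw[OF C2c]
          by (intro connected_avoiding_cw_ends) auto
        moreover have "pt C1 \<in> ?A"
          using rr True ne c C2 arc range by (auto simp: rotation_def rI I_def)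
        moreover have "pt C3 \<notin> ?A"
          using rr True ne c C2 arc range by (auto simp: rotation_def rI I_def)
        ultimately show False
          using C1 C3 by blast
      next
        case False
        let ?A = "cw c ` {ang (pt C2)..ang z}"
        have "A \<subseteq> ?A \<or> A \<inter> ?A = {}"
          using False assms(2,3) z C2A cw[OF z(1)] cw[OF C2c]
          by (intro connected_avoiding_cw_ends) auto
        moreover have "pt C3 \<in> ?A"
          using rr False ne c C2 arc range by (auto simp: rotation_def rI I_def)
        moreover have "pt C1 \<notin> ?A"
          using rr False ne c C2 arc range by (auto simp: rotation_def rI I_def)
        ultimately show False
          using C1 C3 by blast
      qed
    qed
  qed simp
  moreover have "rotation M r I \<in> cyclic_order M r"
    by (auto simp: cyclic_order_def rI I_def)
  ultimately show ?thesis
    unfolding consecutive_def by blast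
qed

text \<open>The rotation is unrolled by adding a full turn to the parameters of the cliques moved to
  the end. This changes no point, and turns the rotated order into the order of the parameters
  \<open>U\<close>, so \<open>S\<close> consists of all cliques between its least and its greatest
  parameter.\<close>

lemma arc_of_consecutive:
  assumes "finite M" "inj_on T M" "r = {(C, C') \<in> M \<times> M. T C < T C'}"
    and window: "\<forall>C\<in>M. \<forall>C'\<in>M. T C' - T C < 2 * pi"
    and S: "consecutive M (cyclic_order M r) S" "S \<noteq> {}"
  obtains a b where "a \<le> b" "\<forall>C\<in>M. cw c (T C) \<in> cis ` {a..b} \<longleftrightarrow> C \<in> S"
    "\<exists>C\<in>S. cis a = cw c (T C)" "\<exists>C\<in>S. cis b = cw c (T C)"
proof -
  obtain I where I: "I \<subseteq> M" "\<forall>x\<in>I. \<forall>y. (y, x) \<in> r \<longrightarrow> y \<in> I"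
    and S': "contiguous M (rotation M r I) S"
    using S(1) by (auto simp: consecutive_def cyclic_order_def)
  define U where "U C = T C + (if C \<in> I then 2 * pi else 0)" for C
  have cwU: "cw c (U C) = cw c (T C)" for C
  proof -
    have "cis (c - (T C + 2 * pi)) = cis (c - T C)"
      by (simp flip: cis_mult cis_divide)
    then show ?thesis
      by (simp add: cw_def U_def)
  qed
  \<comment> \<open>\<open>I\<close> is an initial segment with respect to \<open>T\<close>. This
    keeps the values of \<open>U\<close> within less than one turn, although some of them are
    shifted.\<close>
  have low: "T C < T C'" if "C \<in> I" "C' \<in> M - I" for C C'
  proof (rule ccontr)
    assume "\<not> T C < T C'"
    moreover have "T C \<noteq> T C'"
      using that I(1) inj_onD[OF assms(2), of C C'] by auto
    ultimately have "(C', C) \<in> r"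
      using that I(1) assms(3) by auto
    then show False
      using that I(2) by auto
  qed
  have U_window: "U C' - U C < 2 * pi" if "C \<in> M" "C' \<in> M" for C C'
    using window[rule_format, OF that] low[of C C'] low[of C' C] that by (auto simp: U_def)
  have U_rot: "(C, C') \<in> rotation M r I \<longleftrightarrow> U C < U C'" if "C \<in> M" "C' \<in> M" for C C'
    using window[rule_format, OF that] window[rule_format, OF that(2,1)] low[of C C'] low[of C' C] that
    by (auto simp: U_def rotation_def assms(3))
  have U_inj: "C = C'" if "C \<in> M" "C' \<in> M" "U C = U C'" for C C'
    using inj_onD[OF assms(2), of C C'] window[rule_format, OF that(1,2)]
      window[rule_format, OF that(2,1)] that by (auto simp: U_def split: if_splits)
  have SM: "S \<subseteq> M" and contig: "\<And>x y z. x \<in> S \<Longrightarrow> z \<in> S \<Longrightarrow> y \<in> M \<Longrightarrow> U x < U y \<Longrightarrow> U y < U z \<Longrightarrow> y \<in> S"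
    using S' U_rot unfolding contiguous_def by (blast, meson subsetD)
  have fin: "finite (U ` S)" "U ` S \<noteq> {}" "finite (U ` M)" "U ` M \<noteq> {}"
    using assms(1) SM S(2) finite_subset by auto
  define lo where "lo = Min (U ` S)"
  define hi where "hi = Max (U ` S)"
  define w where "w = Min (U ` M)"
  obtain L where L: "L \<in> S" "U L = lo"
    using Min_in[OF fin(1,2)] by (auto simp: lo_def)
  obtain H where H: "H \<in> S" "U H = hi"
    using Max_in[OF fin(1,2)] by (auto simp: hi_def)
  obtain W where W: "W \<in> M" "U W = w"
    using Min_in[OF fin(3,4)] by (auto simp: w_def)
  have lohi: "lo \<le> U C" "U C \<le> hi" if "C \<in> S" for C
    using that fin by (auto simp: lo_def hi_def)
  have w: "w \<le> U C" "U C < w + 2 * pi" if "C \<in> M" for C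
    using that fin U_window[OF W(1) that] W(2) by (auto simp: w_def)
  have mem: "cw c (T C) \<in> cw c ` {lo..hi} \<longleftrightarrow> C \<in> S" if C: "C \<in> M" for C
  proof -
    have "cw c (U C) \<in> cw c ` {lo..hi} \<longleftrightarrow> lo \<le> U C \<and> U C \<le> hi"
      using L H SM w[of L] w[of H] w[OF C] by (intro cw_mem_arc_iff[of w]) auto
    also have "\<dots> \<longleftrightarrow> C \<in> S"
    proof
      assume "lo \<le> U C \<and> U C \<le> hi"
      then consider "U C = U L" | "U C = U H" | "U L < U C" "U C < U H"
        using L H by linarith
      then show "C \<in> S"
        by cases (use L H SM C U_inj contig in blast)+
    qed (use lohi in auto)
    finally show ?thesis
      by (simp add: cwU)
  qed
  show thesis
  \<comment> \<open>\<open>cis\<close> runs counterclockwise, so the clockwise arc from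
    \<open>lo\<close> to \<open>hi\<close> begins at the angle \<open>c - hi\<close>.\<close>
  proof (rule that[of "c - hi" "c - lo"])
    show "c - hi \<le> c - lo"
      using lohi[OF L(1)] by simp
    show "\<forall>C\<in>M. cw c (T C) \<in> cis ` {c - hi..c - lo} \<longleftrightarrow> C \<in> S"
      using mem by (simp flip: cw_image)
    show "\<exists>C\<in>S. cis (c - hi) = cw c (T C)"
      using H cwU[of H] by (auto simp: cw_def intro!: bexI[of _ H])
    show "\<exists>C\<in>S. cis (c - lo) = cw c (T C)"
      using L cwU[of L] by (auto simp: cw_def intro!: bexI[of _ L])
  qed
qed

text \<open>Each element is ranked by the number of its predecessors, and \<open>c\<close> is the
  inverse of this ranking.\<close>

lemma enumerate_strict_linear_order:
  assumes "finite M" "r \<subseteq> M \<times> M" "strict_linear_order_on M r"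
  obtains c where "bij_betw c {..<card M} M"
    "\<forall>i<card M. \<forall>j<card M. (c i, c j) \<in> r \<longleftrightarrow> i < j"
proof -
  have tr: "trans r" and irr: "irrefl r" and tot: "total_on M r"
    using assms(3) by (auto simp: strict_linear_order_on_def)
  define rank where "rank x = card {y. (y, x) \<in> r}" for x
  have fin: "finite {y. (y, x) \<in> r}" for x
    using assms(1,2) by (auto intro: finite_subset[of _ M])
  have mono: "rank x < rank y" if "(x, y) \<in> r" for x y
    unfolding rank_def
  proof (rule psubset_card_mono[OF fin])
    show "{z. (z, x) \<in> r} \<subset> {z. (z, y) \<in> r}"
      using that tr irr by (auto simp: irrefl_def dest: transD)
  qed
  have iff: "(x, y) \<in> r \<longleftrightarrow> rank x < rank y" if "x \<in> M" "y \<in> M" for x y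
    using mono[of x y] mono[of y x] tot that unfolding total_on_def by fastforce
  have inj: "inj_on rank M"
    using iff tot unfolding inj_on_def total_on_def by (metis less_irrefl)
  have "rank x < card M" if "x \<in> M" for x
    unfolding rank_def using that assms(1,2) irr
    by (intro psubset_card_mono) (auto simp: irrefl_def)
  then have "rank ` M = {..<card M}"
    by (intro card_subset_eq) (auto simp: card_image inj)
  then have bij: "bij_betw rank M {..<card M}"
    using inj by (simp add: bij_betw_def)
  show thesis
  proof (rule that[of "inv_into M rank"])
    show "bij_betw (inv_into M rank) {..<card M} M"
      using bij by (rule bij_betw_inv_into)
    show "\<forall>i<card M. \<forall>j<card M. (inv_into M rank i, inv_into M rank j) \<in> r \<longleftrightarrow> i < j"
      using iff bij by (simp add: bij_betw_def f_inv_into_f inv_into_into)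
  qed
qed

subsection \<open>Regions and gaps\<close>

lemma gapsD:
  assumes "J \<in> gaps V' R' C"
  shows "connected J" "J \<subseteq> circle" "J \<inter> Reg V' R' C = {}"
  using in_components_connected[of J] in_components_subset[of J] assms unfolding gaps_def by auto

lemma connected_subset_gap:
  assumes "J \<in> gaps V' R' C" "connected S" "S \<subseteq> circle - Reg V' R' C" "S \<inter> J \<noteq> {}"
  shows "S \<subseteq> J"
  using assms components_maximal[of J] unfolding gaps_def by blast

text \<open>Exhibits regions as level sets of the map that sends a point to the set of pre-drawn
  vertices whose arcs contain it. This is why two regions are equal or disjoint.\<close>

lemma Reg_iff:
  "x \<in> Reg V' R' C \<longleftrightarrow> x \<in> circle \<and> {v \<in> V'. x \<in> R' v} = C \<inter> V'"
  unfolding Reg_def Reg_plus_def Reg_minus_def by blast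

lemma predrawn_mem_iff: "x \<in> Reg V' R' C \<Longrightarrow> v \<in> V' \<Longrightarrow> x \<in> R' v \<longleftrightarrow> v \<in> C"
  unfolding Reg_def Reg_plus_def Reg_minus_def by blast

lemma Reg_in_circle: "Reg V' R' C \<subseteq> circle"
  using Reg_iff by blast

lemma Reg_eq_if_meet:
  assumes "x \<in> Reg V' R' C" "x \<in> Reg V' R' C'"
  shows "Reg V' R' C = Reg V' R' C'"
proof -
  have "C \<inter> V' = C' \<inter> V'"
    using assms by (simp add: Reg_iff)
  then show ?thesis
    by (simp add: set_eq_iff Reg_iff)
qed

text \<open>The Helly property gives a common point of the arcs of \<open>C\<close>. A further
  vertex whose arc contains this point is adjacent to all of \<open>C\<close>, hence belongs to
  \<open>C\<close> by maximality.\<close>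

lemma ex_clique_points:
  assumes "nhca_rep V E R"
  obtains pt where "\<And>C. C \<in> max_cliques V E \<Longrightarrow> pt C \<in> circle"
    "\<And>C v. C \<in> max_cliques V E \<Longrightarrow> v \<in> V \<Longrightarrow> pt C \<in> R v \<longleftrightarrow> v \<in> C"
proof -
  have arcs: "\<And>v. v \<in> V \<Longrightarrow> closed_arc (R v)"
    and edges: "\<And>u v. u \<in> V \<Longrightarrow> v \<in> V \<Longrightarrow> u \<noteq> v \<Longrightarrow> R u \<inter> R v \<noteq> {} \<longleftrightarrow> {u, v} \<in> E"
    and helly: "\<And>S. S \<subseteq> V \<Longrightarrow> \<forall>u\<in>S. \<forall>v\<in>S. R u \<inter> R v \<noteq> {} \<Longrightarrow> (\<Inter>v\<in>S. R v) \<noteq> {}"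
    using assms by (auto simp: nhca_rep_def circular_arc_rep_def helly_rep_def)
  have "\<exists>x. x \<in> circle \<and> (\<forall>v\<in>V. x \<in> R v \<longleftrightarrow> v \<in> C)" if C: "C \<in> max_cliques V E" for C
  proof (cases "C = {}")
    case True
    \<comment> \<open>Every single vertex is a clique, so the empty clique is maximal only in the
      empty graph, where any point of the circle serves.\<close>
    have "V = {}"
    proof (rule equals0I)
      fix v assume "v \<in> V"
      then have "{v} = C"
        using C True by (auto simp: max_cliques_def clique_def)
      then show False
        using True by simp
    qed
    then show ?thesis
      using norm_one by (intro exI[of _ 1]) simp
  next
    case False
    note CV = max_cliqueD[OF C]
    have "R u \<inter> R v \<noteq> {}" if uv: "u \<in> C" "v \<in> C" for u v
    proof (cases "u = v")
      case True
      then show ?thesis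
        using closed_arcD(4)[OF arcs] CV(1) uv by auto
    next
      case False
      then have "{u, v} \<in> E"
        using CV(2) uv by (simp add: clique_def)
      then show ?thesis
        using edges False CV(1) uv by blast
    qed
    then have "(\<Inter>v\<in>C. R v) \<noteq> {}"
      using helly[OF CV(1)] by blast
    then obtain x where x: "\<And>v. v \<in> C \<Longrightarrow> x \<in> R v"
      by blast
    obtain w where w: "w \<in> C"
      using False by blast
    have "x \<in> circle"
      using x[OF w] closed_arcD(1)[OF arcs] CV(1) w by blast
    moreover have "v \<in> C" if v: "v \<in> V" "x \<in> R v" for v
    proof (rule ccontr)
      assume "v \<notin> C"
      have "{u, v} \<in> E" "{v, u} \<in> E" if "u \<in> C" for u
        using edges[of u v] x[OF that] v that CV(1) \<open>v \<notin> C\<close> by (auto simp: insert_commute)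
      then have "clique (insert v C) E"
        using CV(2) by (auto simp: clique_def)
      then have "insert v C = C"
        using C v(1) CV(1) unfolding max_cliques_def by blast
      then show False
        using \<open>v \<notin> C\<close> by blast
    qed
    ultimately show ?thesis
      using x by blast
  qed
  then have "\<forall>C\<in>max_cliques V E. \<exists>x. x \<in> circle \<and> (\<forall>v\<in>V. x \<in> R v \<longleftrightarrow> v \<in> C)"
    by blast
  from this[THEN bchoice] obtain pt where
    "\<forall>C\<in>max_cliques V E. pt C \<in> circle \<and> (\<forall>v\<in>V. pt C \<in> R v \<longleftrightarrow> v \<in> C)"
    by (elim exE)
  then show thesis
    by (intro that[of pt]) auto
qed

text \<open>If \<open>A\<close> is not a single point, then \<open>p\<close> is interior to it, and
  points slightly counterclockwise of \<open>p\<close> lie in \<open>A\<close>. In clockwise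
  parameters these are the last ones before a full turn; \<open>e\<close> is half the length of the
  arc.\<close>

lemma middle_point_interior:
  assumes "middle_point p A" "\<not> is_singleton A"
  obtains c e where "p = cis c" "e > 0" "e \<le> pi" "\<And>s. 0 < s \<Longrightarrow> s < e \<Longrightarrow> cw c (2 * pi - s) \<in> A"
proof -
  obtain a b where ab: "a \<le> b" "b \<le> a + 2 * pi" "cis ` {a<..<b} \<subseteq> A" "A \<subseteq> cis ` {a..b}"
    "p = cis ((a + b) / 2)" "p \<in> A"
    using assms(1) by (auto simp: middle_point_def)
  have "a \<noteq> b"
  proof
    assume "a = b"
    then have "A = {p}"
      using ab by auto
    then show False
      using assms(2) by simp
  qed
  then have "a < b"
    using ab(1) by simp
  show thesis
  proof (rule that[of "(a + b) / 2" "(b - a) / 2"])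
    fix s assume s: "0 < s" "s < (b - a) / 2"
    have "cw ((a + b) / 2) (2 * pi - s) = cw ((a + b) / 2) (- s)"
      using cw_periodic(1)[of "(a + b) / 2" "- s"] by (simp add: add.commute)
    also have "\<dots> = cis ((a + b) / 2 + s)"
      by (simp add: cw_def)
    also have "\<dots> \<in> A"
    proof (rule subsetD[OF ab(3)], rule imageI)
      show "(a + b) / 2 + s \<in> {a<..<b}"
        using s \<open>a < b\<close> by (auto simp: field_simps)
    qed
    finally show "cw ((a + b) / 2) (2 * pi - s) \<in> A" .
  qed (use ab \<open>a < b\<close> in auto)
qed

section \<open>Separating coinciding positions\<close>

text \<open>Equal positions are pulled apart by moving each one by at most \<open>e\<close> inside
  its admissible set \<open>U i\<close>. Members of a tie share this set, so they can all move to
  the same side, in the order of their indices; a small \<open>e\<close> preserves the order between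
  different positions.\<close>

lemma spread_weakly_increasing:
  fixes s :: "nat \<Rightarrow> real" and U :: "nat \<Rightarrow> real set"
  assumes mono: "\<And>i j. i \<le> j \<Longrightarrow> j < n \<Longrightarrow> s i \<le> s j"
    and window: "\<And>i j. i < n \<Longrightarrow> j < n \<Longrightarrow> s j - s i < K"
    and same: "\<And>i j. i < n \<Longrightarrow> j < n \<Longrightarrow> s i = s j \<Longrightarrow> U i = U j"
    and mem: "\<And>i. i < n \<Longrightarrow> s i \<in> U i"
    and room: "\<And>i j. i < n \<Longrightarrow> j < n \<Longrightarrow> i \<noteq> j \<Longrightarrow> s i = s j \<Longrightarrow>
       \<exists>e>0. {s i..s i + e} \<subseteq> U i \<or> {s i - e..s i} \<subseteq> U i"
  obtains t where "\<And>i j. i < j \<Longrightarrow> j < n \<Longrightarrow> t i < t j" "\<And>i. i < n \<Longrightarrow> t i \<in> U i"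
    "\<And>i j. i < n \<Longrightarrow> j < n \<Longrightarrow> t j - t i < K"
proof -
  define rt where "rt i \<longleftrightarrow> (\<exists>e>0. {s i..s i + e} \<subseteq> U i)" for i
  define lf where "lf i \<longleftrightarrow> (\<exists>e>0. {s i - e..s i} \<subseteq> U i)" for i
  \<comment> \<open>Both nonzero choices increase with the index; the first is nonnegative for moves
    to the right, the second negative for moves to the left.\<close>
  define g where "g i = (if rt i then real i / n else if lf i then real i / n - 1 else 0)" for i
  have g: "\<bar>g i\<bar> \<le> 1" if "i < n" for i
    using that by (auto simp: g_def abs_real_def field_simps)
  define good where "good e i \<longleftrightarrow> (rt i \<longrightarrow> {s i..s i + e} \<subseteq> U i) \<and> (lf i \<longrightarrow> {s i - e..s i} \<subseteq> U i) \<and>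
      (\<forall>j\<in>{..<n}. s j - s i + 2 * e < K \<and> (s i < s j \<longrightarrow> s i + 2 * e < s j))" for e i
  \<comment> \<open>Finitely many requirements are imposed on \<open>e\<close>, and each holds for
    all sufficiently small positive \<open>e\<close>.\<close>
  have "eventually (\<lambda>e. 0 < e \<and> (\<forall>i\<in>{..<n}. good e i)) (at_right 0)"
    unfolding good_def
  proof (intro eventually_ball_finite finite_lessThan ballI eventually_conj)
    show "eventually (\<lambda>e. 0 < e) (at_right (0::real))"
      by (rule eventually_at_right_less)
  next
    fix i assume "i \<in> {..<n}"
    show "eventually (\<lambda>e. rt i \<longrightarrow> {s i..s i + e} \<subseteq> U i) (at_right 0)"
    proof (cases "rt i")
      case True
      then obtain d where "d > 0" "{s i..s i + d} \<subseteq> U i"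
        by (auto simp: rt_def)
      then show ?thesis
        unfolding eventually_at_right_field by (intro exI[of _ d]) (auto intro: subsetD)
    qed simp
    show "eventually (\<lambda>e. lf i \<longrightarrow> {s i - e..s i} \<subseteq> U i) (at_right 0)"
    proof (cases "lf i")
      case True
      then obtain d where "d > 0" "{s i - d..s i} \<subseteq> U i"
        by (auto simp: lf_def)
      then show ?thesis
        unfolding eventually_at_right_field by (intro exI[of _ d]) (auto intro: subsetD)
    qed simp
    fix j assume "j \<in> {..<n}"
    then have "s j - s i < K"
      using \<open>i \<in> {..<n}\<close> window by simp
    then show "eventually (\<lambda>e. s j - s i + 2 * e < K) (at_right 0)"
      unfolding eventually_at_right_field by (intro exI[of _ "(K - (s j - s i)) / 2"]) auto
    show "eventually (\<lambda>e. s i < s j \<longrightarrow> s i + 2 * e < s j) (at_right 0)"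
    proof (cases "s i < s j")
      case True
      then show ?thesis
        unfolding eventually_at_right_field by (intro exI[of _ "(s j - s i) / 2"]) auto
    qed simp
  qed
  then obtain e where e: "e > 0" and good: "\<And>i. i < n \<Longrightarrow> good e i"
    using eventually_happens'[OF trivial_limit_at_right_real] by (metis (no_types, lifting) lessThan_iff)
  have right: "\<And>i. i < n \<Longrightarrow> rt i \<Longrightarrow> {s i..s i + e} \<subseteq> U i"
    and left: "\<And>i. i < n \<Longrightarrow> lf i \<Longrightarrow> {s i - e..s i} \<subseteq> U i"
    and K: "\<And>i j. i < n \<Longrightarrow> j < n \<Longrightarrow> s j - s i + 2 * e < K"
    and sep: "\<And>i j. i < n \<Longrightarrow> j < n \<Longrightarrow> s i < s j \<Longrightarrow> s i + 2 * e < s j"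
    using good unfolding good_def by auto
  define t where "t i = s i + e * g i" for i
  have shift: "- e \<le> e * g i" "e * g i \<le> e" if "i < n" for i
    using g[OF that] e mult_left_mono[of "g i" 1 e] mult_left_mono[of "-1" "g i" e] by auto
  show thesis
  proof (rule that[of t])
    fix i j :: nat assume ij: "i < j" "j < n"
    show "t i < t j"
    proof (cases "s i < s j")
      case True
      then show ?thesis
        using sep[of i j] shift[of i] shift[of j] ij by (simp add: t_def)
    next
      case False
      then have eq: "s i = s j"
        using mono[of i j] ij by simp
      have "U i = U j"
        using same[of i j] eq ij by simp
      then have rl: "rt i = rt j" "lf i = lf j"
        using eq by (auto simp: rt_def lf_def)
      have "rt i \<or> lf i"
        using room[of i j] eq ij by (auto simp: rt_def lf_def)
      moreover have "real i / n < real j / n"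
        using ij by (simp add: divide_strict_right_mono)
      ultimately have "g i < g j"
        using rl by (auto simp: g_def)
      then show ?thesis
        using eq e by (simp add: t_def)
    qed
  next
    fix i assume i: "i < n"
    have "rt i \<Longrightarrow> 0 \<le> g i" "\<not> rt i \<Longrightarrow> lf i \<Longrightarrow> g i \<le> 0" "\<not> rt i \<Longrightarrow> \<not> lf i \<Longrightarrow> g i = 0"
      using i by (auto simp: g_def field_simps)
    then have "rt i \<Longrightarrow> t i \<in> {s i..s i + e}" "\<not> rt i \<Longrightarrow> lf i \<Longrightarrow> t i \<in> {s i - e..s i}"
      "\<not> rt i \<Longrightarrow> \<not> lf i \<Longrightarrow> t i = s i"
      using shift[OF i] e by (auto simp: t_def mult_nonneg_nonpos)
    then show "t i \<in> U i"
      using right[OF i] left[OF i] mem[OF i] by (metis subsetD)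
  next
    fix i j assume "i < n" "j < n"
    then show "t j - t i < K"
      using K[of i j] shift[of i] shift[of j] by (simp add: t_def)
  qed
qed

section \<open>Geometry of the regions of a partial representation\<close>

locale partial_rep =
  fixes V V' :: "'a set" and E :: "'a set set" and R' :: "'a \<Rightarrow> complex set"
  assumes graph: "simple_graph V E"
    and no_universal: "\<not> (\<exists>v. universal_vertex V E v)"
    and partial: "partial_nhca_rep V E V' R'"
    and Reg_nonempty: "\<forall>C\<in>max_cliques V E. Reg V' R' C \<noteq> {}"
begin

abbreviation "M \<equiv> max_cliques V E"
abbreviation "reg C \<equiv> Reg V' R' C"
abbreviation "label x \<equiv> {v \<in> V'. x \<in> R' v}"

lemma V'_subset: "V' \<subseteq> V" and finite_V': "finite V'"
  using partial graph finite_subset by (auto simp: partial_nhca_rep_def simple_graph_def)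

lemma predrawn_arc: "v \<in> V' \<Longrightarrow> closed_arc (R' v)"
  using partial by (auto simp: partial_nhca_rep_def nhca_rep_def circular_arc_rep_def)

text \<open>As \<open>v\<close> is not universal, some maximal clique avoids it; its nonempty region
  lies outside the arc of \<open>v\<close>.\<close>

lemma predrawn_ne_circle:
  assumes "v \<in> V'"
  shows "R' v \<noteq> circle"
proof
  assume full: "R' v = circle"
  obtain C where C: "C \<in> M" "v \<notin> C"
    using max_clique_avoiding_vertex[OF graph] no_universal assms V'_subset by blast
  obtain x where x: "x \<in> reg C"
    using Reg_nonempty C(1) by blast
  then have "x \<in> R' v"
    using full Reg_in_circle by blast
  then show False
    using predrawn_mem_iff[OF x assms] C(2) by simp
qed

lemma predrawn_Int_connected:
  assumes "u \<in> V'" "v \<in> V'"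
  shows "connected (R' u \<inter> R' v)"
  using partial assms connected_empty
  unfolding partial_nhca_rep_def nhca_rep_def normal_rep_def by metis

text \<open>For a fixed pre-drawn \<open>u\<close> in \<open>C\<close>, the complement is the union
  of the complements of the sets \<open>R' u \<inter> R' v\<close>. These are connected by normality
  and share any point outside \<open>R' u\<close>.\<close>

lemma connected_circle_Diff_Reg_plus: "connected (circle - Reg_plus V' R' C)"
proof (cases "C \<inter> V' = {}")
  case True
  then show ?thesis
    by (simp add: Reg_plus_def)
next
  case False
  then obtain u where u: "u \<in> C" "u \<in> V'" by blast
  have sub: "R' v \<subseteq> circle" if "v \<in> V'" for v
    using closed_arcD(1) predrawn_arc that .
  obtain z where z: "z \<in> circle" "z \<notin> R' u"
    using predrawn_ne_circle[OF u(2)] sub[OF u(2)] by blast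
  have "connected (\<Union>v\<in>C \<inter> V'. circle - (R' u \<inter> R' v))"
  proof (rule connected_Union)
    show "\<Inter> ((\<lambda>v. circle - (R' u \<inter> R' v)) ` (C \<inter> V')) \<noteq> {}"
      using z by blast
  qed (use u sub predrawn_Int_connected connected_circle_Diff in blast)
  moreover have "(\<Union>v\<in>C \<inter> V'. circle - (R' u \<inter> R' v)) = circle - Reg_plus V' R' C"
    using u sub by (auto simp: Reg_plus_def)
  ultimately show ?thesis by simp
qed

lemma closed_Reg_minus: "closed (Reg_minus V' R' C)"
  unfolding Reg_minus_def using finite_V' closed_arcD(2) predrawn_arc by (intro closed_UN) auto

text \<open>If a pre-drawn vertex of \<open>C'\<close> is missing from \<open>C\<close>, its arc joins the points of \<open>Reg C'\<close>
  outside \<open>Reg C\<close>; otherwise all of \<open>Reg C'\<close> lies outside \<open>Reg\<^sup>+ C\<close>, whose complement is connected.\<close>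

lemma Reg_subset_gap:
  assumes J: "J \<in> gaps V' R' C" and meet: "reg C' \<inter> J \<noteq> {}"
  shows "reg C' \<subseteq> J"
proof -
  obtain x where x: "x \<in> reg C'" "x \<in> J"
    using meet by blast
  have disj: "reg C' \<inter> reg C = {}"
    using Reg_eq_if_meet[of _ V' R' C' C] x gapsD(3)[OF J] by blast
  have ne: "C' \<inter> V' \<noteq> C \<inter> V'"
    using disj x(1) by (auto simp: Reg_iff)
  show ?thesis
  proof (cases "C' \<inter> V' \<subseteq> C")
    case True
    have sub: "reg C' \<subseteq> circle - Reg_plus V' R' C"
    proof
      fix y assume y: "y \<in> reg C'"
      obtain v where v: "v \<in> C" "v \<in> V'" "v \<notin> C'"
        using True ne by blast
      then have "y \<notin> R' v"
        using predrawn_mem_iff[OF y v(2)] by simp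
      then show "y \<in> circle - Reg_plus V' R' C"
        using v subsetD[OF Reg_in_circle y] by (auto simp: Reg_plus_def)
    qed
    have "circle - Reg_plus V' R' C \<subseteq> J"
      using x sub by (intro connected_subset_gap[OF J] connected_circle_Diff_Reg_plus)
        (auto simp: Reg_def)
    then show ?thesis
      using sub by blast
  next
    case False
    then obtain v where v: "v \<in> C'" "v \<in> V'" "v \<notin> C" by blast
    have sub: "reg C' \<subseteq> R' v"
      using v(1) predrawn_mem_iff[OF _ v(2)] by (meson subsetI)
    have "R' v \<subseteq> J"
    proof (rule connected_subset_gap[OF J])
      show "R' v \<subseteq> circle - reg C"
        using v(3) closed_arcD(1)[OF predrawn_arc[OF v(2)]] predrawn_mem_iff[OF _ v(2)]
        by (meson Diff_iff subsetD subsetI)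
    qed (use x sub closed_arcD(3)[OF predrawn_arc[OF v(2)]] in auto)
    then show ?thesis
      using sub by blast
  qed
qed

text \<open>A second point \<open>y\<close> of the region splits the circle into two arcs starting
  at \<open>cw c t\<close>. The connected complement of \<open>Reg_plus\<close> avoids both points,
  so one of the arcs lies in \<open>Reg_plus\<close>. Close to \<open>cw c t\<close> the closed set
  \<open>Reg_minus\<close> is avoided as well.\<close>

lemma Reg_one_sided_neighbourhood:
  assumes t: "cw c t \<in> reg C" and "\<not> is_singleton (reg C)"
  obtains e where "e > 0" "cw c ` {t..t + e} \<subseteq> reg C \<or> cw c ` {t - e..t} \<subseteq> reg C"
proof -
  define P where "P = Reg_plus V' R' C"
  obtain y where y: "y \<in> reg C" "y \<noteq> cw c t"
    using assms is_singletonI'[of "reg C"] by blast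
  obtain s where s: "c - t - 2 * pi \<le> s" "s < c - t" "y = cis s"
    using ex_cis_in_window[OF subsetD[OF Reg_in_circle y(1)], of "c - t - 2 * pi"] by auto
  have "cis (c - t - 2 * pi) = cw c t"
    by (simp add: cw_def flip: cis_divide)
  then have "s \<noteq> c - t - 2 * pi"
    using y(2) s(3) by blast
  define u where "u = c - s"
  have u: "t < u" "u < t + 2 * pi" "y = cw c u"
    using s \<open>s \<noteq> c - t - 2 * pi\<close> by (auto simp: u_def cw_def)
  have u': "y = cw c (u - 2 * pi)"
    unfolding u(3) by simp
  define A where "A = cw c ` {t..u}"
  define B where "B = cw c ` {u - 2 * pi..t}"
  have xy: "cw c t \<in> P" "y \<in> P"
    using t y by (auto simp: P_def Reg_def)
  have "circle - P \<subseteq> A \<or> (circle - P) \<inter> A = {}"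
    unfolding A_def P_def using xy u connected_circle_Diff_Reg_plus
    by (intro connected_avoiding_cw_ends) (auto simp: P_def)
  moreover have "circle - P \<subseteq> B \<or> (circle - P) \<inter> B = {}"
    unfolding B_def P_def using xy u u' connected_circle_Diff_Reg_plus
    by (intro connected_avoiding_cw_ends) (auto simp: P_def)
  moreover have "A \<inter> B \<subseteq> P"
  proof -
    have "cis ` {c - u..c - t} \<inter> cis ` {c - t..c - u + 2 * pi} \<subseteq> {cis (c - u), cis (c - t)}"
      using u by (intro arc_Int_opposite_arc) auto
    moreover have "c - u + 2 * pi = c - (u - 2 * pi)" by simp
    ultimately have "A \<inter> B \<subseteq> {cw c u, cw c t}"
      unfolding A_def B_def cw_image by (simp only: cw_def)
    then show ?thesis
      using xy u(3) by blast
  qed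
  moreover have "A \<subseteq> circle" "B \<subseteq> circle"
    by (auto simp: A_def B_def)
  ultimately have AB: "A \<subseteq> P \<or> B \<subseteq> P"
    by blast
  have "open (cw c -` (- Reg_minus V' R' C))"
    using closed_Reg_minus continuous_on_cw by (intro open_vimage) auto
  then obtain d where d: "d > 0" "ball t d \<subseteq> cw c -` (- Reg_minus V' R' C)"
    using t openE[of "cw c -` (- Reg_minus V' R' C)" t] by (auto simp: Reg_def)
  \<comment> \<open>Small enough to avoid \<open>Reg_minus\<close> and not to run past
    \<open>y\<close> in either direction.\<close>
  define e where "e = Min {d / 2, u - t, t - (u - 2 * pi)}"
  have e: "e > 0" "e < d" "e \<le> u - t" "e \<le> t - (u - 2 * pi)"
    using d u by (auto simp: e_def)
  have avoid: "cw c ` {t - e..t + e} \<inter> Reg_minus V' R' C = {}"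
  proof -
    have "{t - e..t + e} \<subseteq> ball t d"
      using e by (auto simp: dist_real_def)
    then show ?thesis
      using d(2) by auto
  qed
  have *: "Y \<subseteq> reg C" if "Y \<subseteq> P" "Y \<subseteq> cw c ` {t - e..t + e}" for Y
    using that avoid unfolding Reg_def P_def by blast
  have "cw c ` {t..t + e} \<subseteq> A" "cw c ` {t - e..t} \<subseteq> B"
    using e by (auto simp: A_def B_def)
  moreover have "cw c ` {t..t + e} \<subseteq> cw c ` {t - e..t + e}" "cw c ` {t - e..t} \<subseteq> cw c ` {t - e..t + e}"
    using e by (auto intro!: image_mono)
  ultimately have "cw c ` {t..t + e} \<subseteq> reg C \<or> cw c ` {t - e..t} \<subseteq> reg C"
    using AB * by (meson subset_trans)
  then show thesis
    using that e(1) by blast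
qed

text \<open>Regions may be half-open, so a region need not have a first point after a given
  position. A finite sample that represents every interval of constant label allows a greedy choice
  by minimum.\<close>

lemma finite_label_sample:
  obtains P where "finite P" "P \<subseteq> {0..<2 * pi}"
    "\<And>t. 0 \<le> t \<Longrightarrow> t < 2 * pi \<Longrightarrow>
       \<exists>u\<in>P. \<forall>s. min t u \<le> s \<and> s \<le> max t u \<longrightarrow> label (cw c s) = label (cw c t)"
proof -
  have "\<forall>v\<in>V'. \<exists>a b. a \<le> b \<and> R' v = cis ` {a..b}"
    using predrawn_arc by (simp add: closed_arc_def)
  then obtain a b where ab: "\<And>v. v \<in> V' \<Longrightarrow> a v \<le> b v" "\<And>v. v \<in> V' \<Longrightarrow> R' v = cis ` {a v..b v}"
    by metis
  define Q where "Q = (\<lambda>v. cis (a v)) ` V' \<union> (\<lambda>v. cis (b v)) ` V'"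
  \<comment> \<open>Labels can change only at ends of pre-drawn arcs; \<open>0\<close> and
    \<open>2 * pi\<close> delimit the window.\<close>
  define B where "B = insert (2 * pi) (insert 0 {t \<in> {0..<2 * pi}. cw c t \<in> Q})"
  have inj: "inj_on (cw c) {0..<2 * pi}"
    by (rule inj_onI) (use cw_eqD in \<open>auto simp: abs_real_def\<close>)
  have "finite Q"
    using finite_V' by (simp add: Q_def)
  then have "finite (cw c -` Q \<inter> {0..<2 * pi})"
    using inj by (rule finite_vimage_IntI)
  then have finB: "finite B"
    by (auto simp: B_def elim!: rev_finite_subset)
  \<comment> \<open>A breakpoint represents itself, and a midpoint represents the open interval
    between neighbouring breakpoints.\<close>
  define P where "P = (B \<union> (\<lambda>(x, y). (x + y) / 2) ` (B \<times> B)) \<inter> {0..<2 * pi}"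
  have const: "label (cw c s) = label (cw c t)"
    if pos: "l < s" "s < h" "l < t" "t < h" "0 \<le> l" "h \<le> 2 * pi" "\<forall>x\<in>B. \<not> (l < x \<and> x < h)" for l h s t
  proof -
    have "cw c s \<in> R' v \<longleftrightarrow> cw c t \<in> R' v" if v: "v \<in> V'" for v
    proof -
      let ?S = "cw c ` {l<..<h}"
      have "cw c x \<notin> Q" if x: "l < x" "x < h" for x
      proof
        assume "cw c x \<in> Q"
        then have "x \<in> B"
          using x \<open>0 \<le> l\<close> \<open>h \<le> 2 * pi\<close> by (simp add: B_def)
        then show False
          using x \<open>\<forall>x\<in>B. \<not> (l < x \<and> x < h)\<close> by blast
      qed
      then have "?S \<inter> Q = {}"
        by auto
      then have "cis (a v) \<notin> ?S" "cis (b v) \<notin> ?S"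
        using v by (auto simp: Q_def)
      then have "?S \<subseteq> R' v \<or> ?S \<inter> R' v = {}"
        unfolding ab(2)[OF v] using ab(1)[OF v]
        by (intro connected_avoiding_arc_ends connected_cw_image) auto
      moreover have "cw c s \<in> ?S" "cw c t \<in> ?S"
        using pos by auto
      ultimately show ?thesis
        by blast
    qed
    then show ?thesis by blast
  qed
  show thesis
  proof (rule that[of P])
    show "finite P"
      using finB by (simp add: P_def)
    show "P \<subseteq> {0..<2 * pi}"
      by (simp add: P_def)
    fix t :: real assume t: "0 \<le> t" "t < 2 * pi"
    show "\<exists>u\<in>P. \<forall>s. min t u \<le> s \<and> s \<le> max t u \<longrightarrow> label (cw c s) = label (cw c t)"
    proof (cases "t \<in> B")
      case True
      then show ?thesis
        using t by (intro bexI[of _ t]) (auto simp: P_def)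
    next
      case False
      define l where "l = Max {x \<in> B. x < t}"
      define h where "h = Min {x \<in> B. t < x}"
      have "0 \<in> {x \<in> B. x < t}" "2 * pi \<in> {x \<in> B. t < x}"
        using False t by (auto simp: B_def less_le)
      then have ne: "{x \<in> B. x < t} \<noteq> {}" "{x \<in> B. t < x} \<noteq> {}"
        by blast+
      have l: "l \<in> B" "l < t" and lmax: "\<forall>x\<in>B. x < t \<longrightarrow> x \<le> l"
        using Max_in[OF _ ne(1)] finB by (auto simp: l_def)
      have h: "h \<in> B" "t < h" and hmin: "\<forall>x\<in>B. t < x \<longrightarrow> h \<le> x"
        using Min_in[OF _ ne(2)] finB by (auto simp: h_def)
      have bounds: "0 \<le> l" "h \<le> 2 * pi"
        using l(1) h(1) by (auto simp: B_def)
      have none: "\<forall>x\<in>B. \<not> (l < x \<and> x < h)"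
        using lmax hmin False by (metis linorder_neqE_linordered_idom not_less)
      define u where "u = (l + h) / 2"
      have u: "l < u" "u < h"
        using l h by (auto simp: u_def)
      have "u \<in> P"
        using l(1) h(1) u bounds by (auto simp: P_def u_def)
      moreover have "label (cw c s) = label (cw c t)" if "min t u \<le> s \<and> s \<le> max t u" for s
        using that u l(2) h(2) bounds none by (intro const[of l _ h]) auto
      ultimately show ?thesis by blast
    qed
  qed
qed

subsection \<open>Placing the clique points\<close>

text \<open>Cliques with equal regions may be placed at the same sample point; such ties are
  separated afterwards. The gap condition guarantees that the greedy choice never fails.\<close>

lemma weak_placement:
  assumes D: "D \<in> M" "cis c \<in> reg D"
    and ext: "linear_extension M (clique_prec V E V' R' D (cis c)) r"
    and gap: "\<forall>C\<in>M. \<forall>J\<in>gaps V' R' C. consecutive M (cyclic_order M r) (cliques_meeting V E V' R' J)"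
    and e: "bij_betw e {..<card M} M" "\<forall>i<card M. \<forall>j<card M. (e i, e j) \<in> r \<longleftrightarrow> i < j"
  obtains s where "\<And>i. i < card M \<Longrightarrow> 0 \<le> s i \<and> s i < 2 * pi \<and> cw c (s i) \<in> reg (e i)"
    "\<And>i j. i \<le> j \<Longrightarrow> j < card M \<Longrightarrow> s i \<le> s j"
proof -
  let ?n = "card M"
  define ang where "ang x = Arg2pi (cis c / x)" for x
  have ang: "0 \<le> ang x" "ang x < 2 * pi" for x
    using angle_range by (auto simp: ang_def)
  have cw_ang: "cw c (ang x) = x" if "x \<in> reg C" for x C
    unfolding ang_def using cw_angle subsetD[OF Reg_in_circle that] .
  have cw0: "cw c 0 = cis c"
    by (simp add: cw_def)
  have r: "r \<subseteq> M \<times> M" "trans r" "clique_prec V E V' R' D (cis c) \<subseteq> r"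
    using ext by (auto simp: linear_extension_def strict_linear_order_on_def)
  have eM: "e i \<in> M" if "i < ?n" for i
    using e(1) that by (auto simp: bij_betw_def)
  have r_iff: "(e i, e j) \<in> r \<longleftrightarrow> i < j" if "i < ?n" "j < ?n" for i j
    using e(2) that by blast
  have n: "0 < ?n"
    using D(1) finite_max_cliques[OF graph] card_gt_0_iff by blast
  obtain k where k: "k < ?n" "e k = D"
    using D(1) bij_betw_imp_surj_on[OF e(1)] by (metis imageE lessThan_iff)
  \<comment> \<open>\<open>clique_prec\<close> puts \<open>D\<close> before every other clique, so
    the enumeration starts with \<open>D\<close>, which can be placed at parameter
    \<open>0\<close>.\<close>
  have "k = 0"
  proof (rule ccontr)
    assume "k \<noteq> 0"
    then have "e 0 \<noteq> D"
      using inj_onD[OF bij_betw_imp_inj_on[OF e(1)], of k 0] k n by auto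
    then have "(e k, e 0) \<in> clique_prec V E V' R' D (cis c)"
      using k D(1) eM[OF n] by (simp add: clique_prec_def)
    then show False
      using r(3) r_iff[OF k(1) n] by auto
  qed
  then have e0: "e 0 = D"
    using k by simp
  have e_ne_D: "e i \<noteq> D" if "0 < i" "i < ?n" for i
    using inj_onD[OF bij_betw_imp_inj_on[OF e(1)], of i 0] that n e0 by auto
  obtain Q where Q: "finite Q" "Q \<subseteq> {0..<2 * pi}"
    and Q_rep: "\<And>t. 0 \<le> t \<Longrightarrow> t < 2 * pi \<Longrightarrow>
       \<exists>u\<in>Q. \<forall>s. min t u \<le> s \<and> s \<le> max t u \<longrightarrow> label (cw c s) = label (cw c t)"
    by (rule finite_label_sample[of c]) blast
  define P where "P = insert 0 Q"
  have P: "finite P" "0 \<in> P" "\<And>u. u \<in> P \<Longrightarrow> 0 \<le> u" "\<And>u. u \<in> P \<Longrightarrow> u < 2 * pi"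
    using Q by (auto simp: P_def)
  have rep: "\<exists>u\<in>P. \<forall>s. min t u \<le> s \<and> s \<le> max t u \<longrightarrow> cw c s \<in> reg C"
    if t: "0 \<le> t" "t < 2 * pi" "cw c t \<in> reg C" for t C
  proof -
    obtain u where "u \<in> Q" "\<forall>s. min t u \<le> s \<and> s \<le> max t u \<longrightarrow> label (cw c s) = label (cw c t)"
      using Q_rep[OF t(1,2)] by blast
    moreover have "cw c s \<in> reg C" if "label (cw c s) = label (cw c t)" for s
      using t(3) that by (simp add: Reg_iff)
    ultimately show ?thesis
      unfolding P_def by blast
  qed
  define N where "N x C = {u \<in> P. cw c u \<in> reg C \<and> x \<le> u}" for x C
  \<comment> \<open>Every clique takes the first sample point of its region at or after the previous
    position. The minimum has this meaning only for nonempty sets; \<open>N_ne\<close> shows by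
    strong induction that they are nonempty.\<close>
  define s where "s = rec_nat 0 (\<lambda>i x. Min (N x (e (Suc i))))"
  have s0: "s 0 = 0" and sS: "s (Suc i) = Min (N (s i) (e (Suc i)))" for i
    by (simp_all add: s_def)
  have finN: "finite (N x C)" for x C
    using P(1) by (simp add: N_def)
  have s_in: "s (Suc i) \<in> N (s i) (e (Suc i))" if "N (s i) (e (Suc i)) \<noteq> {}" for i
    unfolding sS using Min_in[OF finN that] .
  have s_le: "s (Suc i) \<le> u" if "u \<in> N (s i) (e (Suc i))" for i u
    unfolding sS using Min_le[OF finN that] .
  have N_ne: "N (s i) (e (Suc i)) \<noteq> {}" if "Suc i < ?n" for i
    using that
  proof (induction i rule: less_induct)
    case (less i)
    show ?case
    proof
      assume empty: "N (s i) (e (Suc i)) = {}"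
      have prev: "s j \<in> P \<and> cw c (s j) \<in> reg (e j)" if "j \<le> i" for j
      proof (cases j)
        case 0
        then show ?thesis
          using P(2) D(2) e0 s0 cw0 by simp
      next
        case (Suc j')
        then have "s j \<in> N (s j') (e j)"
          using less that s_in[of j'] by simp
        then show ?thesis
          by (simp add: N_def)
      qed
      let ?C = "e (Suc i)"
      define B where "B = {u \<in> P. cw c u \<in> reg ?C}"
      obtain x0 where x0: "x0 \<in> reg ?C"
        using Reg_nonempty eM[OF less.prems] by blast
      have "B \<noteq> {}"
        using rep[of "ang x0" ?C] ang[of x0] cw_ang[OF x0] x0 by (fastforce simp: B_def)
      moreover have finB: "finite B"
        using P(1) by (simp add: B_def)
      ultimately have b_in: "Max B \<in> B"
        by (intro Max_in)
      \<comment> \<open>The last sample point of \<open>?C\<close>; by assumption all of them lie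
        before \<open>s i\<close>.\<close>
      define b where "b = Max B"
      have b: "b \<in> P" "cw c b \<in> reg ?C"
        using b_in by (auto simp: B_def b_def)
      have b_max: "u \<le> b" if "u \<in> P" "cw c u \<in> reg ?C" for u
        using finB that by (auto simp: B_def b_def intro: Max_ge)
      have "b < s i"
        using empty b by (force simp: N_def)
      \<comment> \<open>The first clique placed after \<open>b\<close> is \<open>?K\<close>; its
        predecessor \<open>?L\<close> is still placed at or before \<open>b\<close>.\<close>
      define k where "k = (LEAST k. b < s k)"
      have k: "b < s k" "k \<le> i"
        unfolding k_def using \<open>b < s i\<close> by (rule LeastI, rule Least_le)
      have "k \<noteq> 0"
        using k(1) P(3)[OF b(1)] s0 by (intro notI) simp
      then obtain l where l: "k = Suc l"
        using not0_implies_Suc by blast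
      have sl: "s l \<le> b"
        using not_less_Least[of l "\<lambda>k. b < s k"] l by (simp add: k_def)
      let ?L = "e l" and ?K = "e (Suc l)"
      have li: "l < i" "Suc l < ?n" "l < ?n"
        using k(2) l less.prems by auto
      have L: "s l \<in> P" "cw c (s l) \<in> reg ?L"
        using prev[of l] li by auto
      have K: "s (Suc l) \<in> P" "cw c (s (Suc l)) \<in> reg ?K" "b < s (Suc l)"
        using prev[of "Suc l"] li k(1) l by auto
      have K_first: "b < u" if "u \<in> P" "cw c u \<in> reg ?K" "s l \<le> u" for u
        using s_le[of u l] that K(3) by (simp add: N_def)
      have L_K: "cw c (s l) \<notin> reg ?K"
        using K_first[OF L(1)] sl by auto
      have b_K: "cw c b \<notin> reg ?K"
        using K_first[OF b(1)] sl by auto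
      \<comment> \<open>Extends \<open>K_first\<close> from sample points to all points: the label
        is constant between \<open>y\<close> and its sample point, and this interval would reach
        \<open>b\<close> or \<open>s l\<close>, where the region of \<open>?K\<close> is
        absent.\<close>
      have K_out: "y < s l \<or> b < y" if y: "0 \<le> y" "y < 2 * pi" "cw c y \<in> reg ?K" for y
      proof (rule ccontr)
        assume "\<not> (y < s l \<or> b < y)"
        then have yb: "s l \<le> y" "y \<le> b" by auto
        obtain u where u: "u \<in> P" "\<And>s. min y u \<le> s \<Longrightarrow> s \<le> max y u \<Longrightarrow> cw c s \<in> reg ?K"
          using rep[OF y] by blast
        show False
        proof (cases "s l \<le> u")
          case True
          have "cw c u \<in> reg ?K"
            using u(2) by simp
          then have "b < u"
            using K_first u(1) True by blast
          then show False
            using u(2)[of b] b_K yb by simp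
        next
          case False
          then show False
            using u(2)[of "s l"] L_K yb by simp
        qed
      qed
      have neD: "?C \<noteq> D" "?K \<noteq> D"
        using e_ne_D li less.prems by auto
      \<comment> \<open>Since \<open>?K\<close> precedes \<open>?C\<close> in \<open>r\<close>,
        \<open>clique_prec\<close> cannot demand the opposite. So some point of
        \<open>reg ?K\<close> comes no later than some point of \<open>reg ?C\<close>.\<close>
      have "(?C, ?K) \<notin> r"
        using r_iff[of "Suc i" "Suc l"] li less.prems by simp
      then have "(?C, ?K) \<notin> clique_prec V E V' R' D (cis c)"
        using r(3) by blast
      then obtain x y where xy: "x \<in> reg ?C" "y \<in> reg ?K" "ang y \<le> ang x"
        using neD eM[OF less.prems] eM[OF li(2)]
        by (auto simp: clique_prec_def clockwise_less_def ang_def not_less)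
      \<comment> \<open>If \<open>y\<close> came after \<open>b\<close>, the constant label between
        \<open>x\<close> and its sample point, which is at most \<open>b\<close>, would extend over
        \<open>y\<close> and identify the two regions.\<close>
      have "\<not> b < ang y"
      proof
        assume yb: "b < ang y"
        obtain u where u: "u \<in> P" "\<And>s. min (ang x) u \<le> s \<Longrightarrow> s \<le> max (ang x) u \<Longrightarrow> cw c s \<in> reg ?C"
          using rep[of "ang x" ?C] ang cw_ang[OF xy(1)] xy(1) by (metis (no_types, lifting))
        have "u \<le> b"
          using b_max[OF u(1)] u(2)[of u] by simp
        then have "y \<in> reg ?C"
          using u(2)[of "ang y"] yb xy(3) cw_ang[OF xy(2)] by simp
        then have "reg ?C = reg ?K"
          using Reg_eq_if_meet xy(2) by blast
        then show False
          using b(2) b_K by simp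
      qed
      then have ay: "ang y < s l"
        using K_out[of "ang y"] ang cw_ang[OF xy(2)] xy(2) by auto
      \<comment> \<open>This gap of \<open>?K\<close> contains the position of \<open>?L\<close>,
        and also that of \<open>b\<close>, because no point of \<open>reg ?K\<close> lies between
        them.\<close>
      define J where "J = connected_component_set (circle - reg ?K) (cw c (s l))"
      have J: "J \<in> gaps V' R' ?K"
        unfolding J_def gaps_def using L_K by (intro componentsI) simp
      have seg: "cw c ` {s l..b} \<subseteq> circle - reg ?K"
      proof
        fix z assume "z \<in> cw c ` {s l..b}"
        then obtain t where t: "s l \<le> t" "t \<le> b" "z = cw c t" by auto
        have "0 \<le> t" "t < 2 * pi"
          using t P(3)[OF L(1)] P(4)[OF b(1)] by auto
        then have "cw c t \<notin> reg ?K"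
          using K_out[of t] t by auto
        then show "z \<in> circle - reg ?K"
          using t by simp
      qed
      have slJ: "cw c (s l) \<in> J"
        unfolding J_def using L_K by (simp add: connected_component_refl)
      have "cw c (s l) \<in> cw c ` {s l..b}"
        using sl by simp
      then have "cw c ` {s l..b} \<subseteq> J"
        using slJ by (intro connected_subset_gap[OF J _ seg] connected_cw_image connected_Icc) blast
      then have bJ: "cw c b \<in> J"
        using sl by auto
      have meets: "X \<in> cliques_meeting V E V' R' J" if "X \<in> M" "z \<in> reg X" "z \<in> J" for X z
        using that by (auto simp: cliques_meeting_def)
      \<comment> \<open>\<open>?L\<close> and \<open>?C\<close> meet \<open>J\<close>, but
        \<open>?K\<close> between them does not, so the consecutive set wraps around the start of
        the order, where \<open>D\<close> stands.\<close>
      have "D \<in> cliques_meeting V E V' R' J"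
      proof (rule consecutive_wraps_around[OF gap[rule_format, OF eM[OF li(2)] J] r(2,1)])
        show "(?L, ?K) \<in> r" "(?K, ?C) \<in> r"
          using r_iff li less.prems by auto
        show "?L \<in> cliques_meeting V E V' R' J" "?C \<in> cliques_meeting V E V' R' J"
          using meets eM[OF li(3)] eM[OF less.prems] L(2) slJ b(2) bJ by blast+
        show "?K \<notin> cliques_meeting V E V' R' J"
          using gapsD(3)[OF J] by (auto simp: cliques_meeting_def)
        show "D = ?L \<or> (D, ?L) \<in> r"
          using r_iff[OF n li(3)] e0 by (cases l) auto
      qed
      then have "reg D \<subseteq> J"
        using Reg_subset_gap[OF J] by (simp add: cliques_meeting_def)
      then have pJ: "cw c 0 \<in> J"
        using D(2) cw0 by auto
      have JK: "z \<notin> J" if "z \<in> reg ?K" for z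
        using that gapsD(3)[OF J] by blast
      have "y \<notin> J"
        using JK xy(2) .
      then have "ang y \<noteq> 0"
        using pJ cw_ang[OF xy(2)] by metis
      then have "0 < ang y"
        using ang(1)[of y] by simp
      \<comment> \<open>Both ends of this arc lie in \<open>reg ?K\<close>, hence outside
        \<open>J\<close>. It contains the point at \<open>s l\<close> but not the starting point,
        whereas \<open>J\<close> contains both.\<close>
      let ?A = "cw c ` {ang y..s (Suc l)}"
      have "J \<subseteq> ?A \<or> J \<inter> ?A = {}"
        using gapsD[OF J] JK[OF K(2)] \<open>y \<notin> J\<close> cw_ang[OF xy(2)] ay sl K(3)
        by (intro connected_avoiding_cw_ends) auto
      moreover have "cw c (s l) \<in> ?A"
        using ay sl K(3) by auto
      moreover have "cw c 0 \<notin> ?A"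
        using cw_mem_arc_iff[of 0 "ang y" "s (Suc l)" 0 c] \<open>0 < ang y\<close> P(4)[OF K(1)] by simp
      ultimately show False
        using slJ pJ by blast
    qed
  qed
  have s_all: "s j \<in> P \<and> cw c (s j) \<in> reg (e j)" if "j < ?n" for j
  proof (cases j)
    case 0
    then show ?thesis
      using P(2) D(2) e0 s0 cw0 by simp
  next
    case (Suc i)
    then show ?thesis
      using s_in[OF N_ne, of i] that by (simp add: N_def)
  qed
  have s_mono: "s i \<le> s j" if "i \<le> j" "j < ?n" for i j
    using that
  proof (induction j rule: dec_induct)
    case (step j)
    then show ?case
      using s_in[OF N_ne, of j] by (simp add: N_def)
  qed simp
  show thesis
    using that[of s] s_all s_mono P(3,4) by blast
qed

text \<open>Cliques tied in the weak placement have equal regions, and these are not single points,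
  so each tie has room on at least one side. The separated parameters may leave
  \<open>{0..<2 * pi}\<close>, but they stay within less than one turn of each other.\<close>

lemma strict_placement:
  assumes D: "D \<in> M" "cis c \<in> reg D"
    and ext: "linear_extension M (clique_prec V E V' R' D (cis c)) r"
    and single: "\<forall>C\<in>M. \<forall>C'\<in>M. C \<noteq> C' \<and> reg C = reg C' \<longrightarrow> \<not> is_singleton (reg C)"
    and gap: "\<forall>C\<in>M. \<forall>J\<in>gaps V' R' C. consecutive M (cyclic_order M r) (cliques_meeting V E V' R' J)"
  obtains T where "\<forall>C\<in>M. cw c (T C) \<in> reg C" "inj_on T M"
    "r = {(C, C') \<in> M \<times> M. T C < T C'}" "\<forall>C\<in>M. \<forall>C'\<in>M. T C' - T C < 2 * pi"
proof -
  let ?n = "card M"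
  have r: "r \<subseteq> M \<times> M" "strict_linear_order_on M r"
    using ext by (auto simp: linear_extension_def)
  obtain e where e: "bij_betw e {..<?n} M" "\<forall>i<?n. \<forall>j<?n. (e i, e j) \<in> r \<longleftrightarrow> i < j"
    using enumerate_strict_linear_order[OF finite_max_cliques[OF graph] r] .
  obtain s where s: "\<And>i. i < ?n \<Longrightarrow> 0 \<le> s i \<and> s i < 2 * pi \<and> cw c (s i) \<in> reg (e i)"
    and s_mono: "\<And>i j. i \<le> j \<Longrightarrow> j < ?n \<Longrightarrow> s i \<le> s j"
    by (rule weak_placement[OF D ext gap e]) blast
  have eM: "e i \<in> M" if "i < ?n" for i
    using e(1) that by (auto simp: bij_betw_def)
  define U where "U i = {t. cw c t \<in> reg (e i)}" for i
  have same: "reg (e i) = reg (e j)" if "i < ?n" "j < ?n" "s i = s j" for i j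
    using Reg_eq_if_meet[of "cw c (s i)"] s[OF that(1)] s[OF that(2)] that(3) by metis
  obtain t where t_mono: "\<And>i j. i < j \<Longrightarrow> j < ?n \<Longrightarrow> t i < t j"
    and t_mem: "\<And>i. i < ?n \<Longrightarrow> t i \<in> U i"
    and t_window: "\<And>i j. i < ?n \<Longrightarrow> j < ?n \<Longrightarrow> t j - t i < 2 * pi"
  proof (rule spread_weakly_increasing[of ?n s "2 * pi" U])
    fix i j assume ij: "i < ?n" "j < ?n"
    show "s j - s i < 2 * pi"
      using s[OF ij(1)] s[OF ij(2)] by linarith
    show "U i = U j" if "s i = s j"
      using same[OF ij that] by (simp add: U_def)
    show "\<exists>d>0. {s i..s i + d} \<subseteq> U i \<or> {s i - d..s i} \<subseteq> U i" if "i \<noteq> j" "s i = s j"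
    proof -
      have "e i \<noteq> e j"
        using inj_onD[OF bij_betw_imp_inj_on[OF e(1)], of i j] ij that(1) by auto
      then have "\<not> is_singleton (reg (e i))"
        using single eM ij same[OF ij that(2)] by blast
      then obtain d where d: "d > 0"
        "cw c ` {s i..s i + d} \<subseteq> reg (e i) \<or> cw c ` {s i - d..s i} \<subseteq> reg (e i)"
        using Reg_one_sided_neighbourhood[of c "s i" "e i"] s[OF ij(1)] by blast
      then show ?thesis
        by (intro exI[of _ d]) (auto simp: U_def image_subset_iff)
    qed
  next
    fix i assume "i < ?n"
    then show "s i \<in> U i"
      using s by (simp add: U_def)
  qed (use s_mono in auto)
  define T where "T C = t (inv_into {..<?n} e C)" for C
  have Te: "T (e i) = t i" if "i < ?n" for i
    unfolding T_def using inv_into_f_f[OF bij_betw_imp_inj_on[OF e(1)], of i] that by simp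
  have idx: "\<exists>i<?n. C = e i" if "C \<in> M" for C
    using that bij_betw_imp_surj_on[OF e(1)] by (metis imageE lessThan_iff)
  have t_iff: "t i < t j \<longleftrightarrow> i < j" if "i < ?n" "j < ?n" for i j
    using t_mono[of i j] t_mono[of j i] that by (cases i j rule: linorder_cases) auto
  show thesis
  proof (rule that[of T])
    show "\<forall>C\<in>M. cw c (T C) \<in> reg C"
    proof
      fix C assume "C \<in> M"
      then obtain i where "i < ?n" "C = e i"
        using idx by blast
      then show "cw c (T C) \<in> reg C"
        using t_mem[of i] Te[of i] by (simp add: U_def)
    qed
    show "inj_on T M"
    proof (rule inj_onI)
      fix C C' assume "C \<in> M" "C' \<in> M" and eq: "T C = T C'"
      then obtain i j where ij: "i < ?n" "C = e i" "j < ?n" "C' = e j"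
        using idx by meson
      then have "t i = t j"
        using eq Te by simp
      then have "i = j"
        using t_iff[of i j] t_iff[of j i] ij by simp
      then show "C = C'"
        using ij by simp
    qed
    show "r = {(C, C') \<in> M \<times> M. T C < T C'}"
    proof -
      have "(C, C') \<in> r \<longleftrightarrow> T C < T C'" if CC: "C \<in> M" "C' \<in> M" for C C'
      proof -
        obtain i j where ij: "i < ?n" "C = e i" "j < ?n" "C' = e j"
          using idx CC by meson
        then show ?thesis
          using e(2) Te t_iff by simp
      qed
      then show ?thesis
        using r(1) by auto
    qed
    show "\<forall>C\<in>M. \<forall>C'\<in>M. T C' - T C < 2 * pi"
    proof (intro ballI)
      fix C C' assume "C \<in> M" "C' \<in> M"
      then obtain i j where ij: "i < ?n" "C = e i" "j < ?n" "C' = e j"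
        using idx by meson
      then show "T C' - T C < 2 * pi"
        using Te t_window by simp
    qed
  qed
qed

subsection \<open>Extensions and orders\<close>

text \<open>Clique points lie in exactly the right arcs: for pre-drawn vertices because they lie in
  the regions, for the others by the choice of the arc. Adjacency and the Helly property are then
  witnessed by clique points; normality needs in addition that a new arc never covers the circle
  together with another arc.\<close>

lemma extension_from_placement:
  assumes T: "\<forall>C\<in>M. cw c (T C) \<in> reg C" "inj_on T M"
    "r = {(C, C') \<in> M \<times> M. T C < T C'}" "\<forall>C\<in>M. \<forall>C'\<in>M. T C' - T C < 2 * pi"
    and vert: "\<forall>v\<in>V. consecutive M (cyclic_order M r) (cliques_containing V E v)"
    and pair: "\<forall>u w. universal_pair V E u w \<longrightarrow>
      consecutive M (cyclic_order M r) (cliques_containing V E u \<inter> cliques_containing V E w)"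
  obtains R where "nhca_rep V E R" "extends_rep V' R' R"
proof -
  define pt where "pt C = cw c (T C)" for C
  have pt: "pt C \<in> reg C" "pt C \<in> circle" if "C \<in> M" for C
    using T(1) that by (auto simp: pt_def)
  have ex_clique: "\<exists>C\<in>M. v \<in> C" if "v \<in> V" for v
    using vertex_in_max_clique[OF graph that] by blast
  have ex_avoiding: "\<exists>C\<in>M. v \<notin> C" if "v \<in> V" for v
    using max_clique_avoiding_vertex[OF graph that] no_universal by blast
  have edge: "{u, v} \<in> E \<longleftrightarrow> (\<exists>C\<in>M. u \<in> C \<and> v \<in> C)" if "u \<in> V" "v \<in> V" "u \<noteq> v" for u v
    using edge_iff_common_max_clique[OF graph that] .
  have arc: "\<exists>a b. a \<le> b \<and> (\<forall>C\<in>M. pt C \<in> cis ` {a..b} \<longleftrightarrow> C \<in> S) \<and>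
      (\<exists>C\<in>S. cis a = pt C) \<and> (\<exists>C\<in>S. cis b = pt C)"
    if "consecutive M (cyclic_order M r) S" "S \<noteq> {}" for S
    unfolding pt_def
    by (rule arc_of_consecutive[OF finite_max_cliques[OF graph] T(2-4) that, of c]) blast
  have "\<forall>v\<in>V. \<exists>a b. a \<le> b \<and> (\<forall>C\<in>M. pt C \<in> cis ` {a..b} \<longleftrightarrow> v \<in> C) \<and>
      (\<exists>C\<in>M. v \<in> C \<and> cis a = pt C) \<and> (\<exists>C\<in>M. v \<in> C \<and> cis b = pt C)"
  proof
    fix v assume v: "v \<in> V"
    have "cliques_containing V E v \<noteq> {}"
      using ex_clique[OF v] by (auto simp: cliques_containing_def)
    from arc[OF vert[rule_format, OF v] this] obtain a b where ab: "a \<le> b"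
      "\<forall>C\<in>M. pt C \<in> cis ` {a..b} \<longleftrightarrow> C \<in> cliques_containing V E v"
      "\<exists>C\<in>cliques_containing V E v. cis a = pt C" "\<exists>C\<in>cliques_containing V E v. cis b = pt C"
      by (elim exE conjE)
    have "\<forall>C\<in>M. pt C \<in> cis ` {a..b} \<longleftrightarrow> v \<in> C"
      using ab(2) by (simp add: cliques_containing_def)
    moreover have "\<exists>C\<in>M. v \<in> C \<and> cis a = pt C" "\<exists>C\<in>M. v \<in> C \<and> cis b = pt C"
      using ab(3,4) by (auto simp: cliques_containing_def)
    ultimately show "\<exists>a b. a \<le> b \<and> (\<forall>C\<in>M. pt C \<in> cis ` {a..b} \<longleftrightarrow> v \<in> C) \<and>
      (\<exists>C\<in>M. v \<in> C \<and> cis a = pt C) \<and> (\<exists>C\<in>M. v \<in> C \<and> cis b = pt C)"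
      using ab(1) by (intro exI[of _ a] exI[of _ b] conjI)
  qed
  from this[THEN bchoice] obtain a where "\<forall>v\<in>V. \<exists>b. a v \<le> b \<and>
      (\<forall>C\<in>M. pt C \<in> cis ` {a v..b} \<longleftrightarrow> v \<in> C) \<and>
      (\<exists>C\<in>M. v \<in> C \<and> cis (a v) = pt C) \<and> (\<exists>C\<in>M. v \<in> C \<and> cis b = pt C)"
    by (elim exE)
  from this[THEN bchoice] obtain b where ab: "\<forall>v\<in>V. a v \<le> b v \<and>
      (\<forall>C\<in>M. pt C \<in> cis ` {a v..b v} \<longleftrightarrow> v \<in> C) \<and>
      (\<exists>C\<in>M. v \<in> C \<and> cis (a v) = pt C) \<and> (\<exists>C\<in>M. v \<in> C \<and> cis (b v) = pt C)"
    by (elim exE)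
  define R where "R v = (if v \<in> V' then R' v else cis ` {a v..b v})" for v
  have R_old: "R v = R' v" if "v \<in> V'" for v
    using that by (simp add: R_def)
  have R_new: "R v = cis ` {a v..b v}" if "v \<notin> V'" for v
    using that by (simp add: R_def)
  have R_arc: "closed_arc (R v)" if "v \<in> V" for v
  proof (cases "v \<in> V'")
    case False
    then show ?thesis
      unfolding R_new[OF False] closed_arc_def using ab that by blast
  qed (simp add: R_old predrawn_arc)
  note R_props = closed_arcD[OF R_arc]
  have R_pt: "pt C \<in> R v \<longleftrightarrow> v \<in> C" if "C \<in> M" "v \<in> V" for C v
    using predrawn_mem_iff[OF pt(1)[OF that(1)], of v] ab that by (simp add: R_def)
  have R_ne_circle: "R v \<noteq> circle" if "v \<in> V" for v
    using ex_avoiding[OF that] R_pt[OF _ that] pt(2) by blast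
  \<comment> \<open>The ends of \<open>R u\<close> are points of cliques containing
    \<open>u\<close>. Without a common clique they avoid \<open>R v\<close>, so \<open>R v\<close>
    lies inside \<open>R u\<close>; then the point of any clique of \<open>v\<close> is also in
    \<open>R u\<close>.\<close>
  have meet_new: "\<exists>C\<in>M. u \<in> C \<and> v \<in> C"
    if u: "u \<in> V" "u \<notin> V'" and v: "v \<in> V" and meet: "R u \<inter> R v \<noteq> {}" for u v
  proof (rule ccontr)
    assume no: "\<not> ?thesis"
    have no': "x \<notin> R v" if "\<exists>C\<in>M. u \<in> C \<and> x = pt C" for x
      using that no R_pt[OF _ v] by auto
    then have "cis (a u) \<notin> R v" "cis (b u) \<notin> R v"
      using ab u(1) by simp_all
    then have "R v \<subseteq> R u \<or> R v \<inter> R u = {}"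
      unfolding R_new[OF u(2)] using ab[rule_format, OF u(1)] R_props[OF v]
      by (intro connected_avoiding_arc_ends) auto
    then have "R v \<subseteq> R u"
      using meet by blast
    moreover obtain C where "C \<in> M" "v \<in> C"
      using ex_clique[OF v] by blast
    ultimately show False
      using no R_pt[of C v] R_pt[of C u] u v by blast
  qed
  have meet_iff: "R u \<inter> R v \<noteq> {} \<longleftrightarrow> {u, v} \<in> E" if uv: "u \<in> V" "v \<in> V" "u \<noteq> v" for u v
  proof
    assume meet: "R u \<inter> R v \<noteq> {}"
    consider "u \<in> V'" "v \<in> V'" | "u \<notin> V'" | "v \<notin> V'" by blast
    then show "{u, v} \<in> E"
    proof cases
      case 1
      then show ?thesis
        using meet R_old partial uv(3)
        by (auto simp: partial_nhca_rep_def nhca_rep_def circular_arc_rep_def)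
    next
      case 2
      then show ?thesis
        using meet_new uv meet edge by blast
    next
      case 3
      then show ?thesis
        using meet_new[OF uv(2) 3 uv(1)] uv meet edge by blast
    qed
  next
    assume "{u, v} \<in> E"
    then obtain C where "C \<in> M" "u \<in> C" "v \<in> C"
      using edge[OF uv] by blast
    then show "R u \<inter> R v \<noteq> {}"
      using R_pt uv by blast
  qed
  \<comment> \<open>If the arcs of \<open>u\<close> and \<open>w\<close> covered the circle, both ends of \<open>R u\<close> would be points of common
    cliques, so the arc spanned by the common cliques would contain \<open>R u\<close>.\<close>
  have no_cover: "R u \<union> R w \<noteq> circle" if u: "u \<in> V" "u \<notin> V'" and w: "w \<in> V" for u w
  proof
    assume cover: "R u \<union> R w = circle"
    have all: "u \<in> C \<or> w \<in> C" if "C \<in> M" for C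
      using cover pt(2)[OF that] R_pt[OF that u(1)] R_pt[OF that w] by blast
    have ends: "cis (a u) \<in> R w" "cis (b u) \<in> R w"
      using arc_ends_in_closed_cover[of "a u" "b u" "R w"] ab[rule_format, OF u(1)]
        R_ne_circle[OF u(1)] R_props(2)[OF w] cover unfolding R_new[OF u(2)] by auto
    obtain A where A: "A \<in> M" "u \<in> A" "cis (a u) = pt A"
      using ab[rule_format, OF u(1)] by blast
    obtain B where B: "B \<in> M" "u \<in> B" "cis (b u) = pt B"
      using ab[rule_format, OF u(1)] by blast
    have wA: "w \<in> A" and wB: "w \<in> B"
      using ends A B R_pt w by auto
    have "u \<noteq> w"
      using cover R_ne_circle[OF u(1)] by auto
    then have "{u, w} \<in> E"
      using edge[OF u(1) w] A wA by blast
    then have up: "universal_pair V E u w"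
      using universal_pair_if_cover[OF graph u(1) w] all by blast
    let ?S = "cliques_containing V E u \<inter> cliques_containing V E w"
    have S: "C \<in> ?S \<longleftrightarrow> u \<in> C \<and> w \<in> C" if "C \<in> M" for C
      using that by (simp add: cliques_containing_def)
    have "?S \<noteq> {}"
      using S[OF A(1)] A(2) wA by blast
    from arc[OF pair[rule_format, OF up] this] obtain a' b' where ab': "a' \<le> b'"
      "\<forall>C\<in>M. pt C \<in> cis ` {a'..b'} \<longleftrightarrow> C \<in> ?S"
      by (elim exE conjE)
    \<comment> \<open>\<open>X\<close> provides a point off both arcs, which forces the inclusion.
      \<open>Y\<close> contains \<open>u\<close> but not \<open>w\<close>, so its point lies in
      \<open>R u\<close> but cannot lie on the arc of the common cliques.\<close>
    obtain X where X: "X \<in> M" "u \<notin> X"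
      using ex_avoiding[OF u(1)] by blast
    obtain Y where Y: "Y \<in> M" "w \<notin> Y"
      using ex_avoiding[OF w] by blast
    have "cis ` {a u..b u} \<subseteq> cis ` {a'..b'}"
    proof (rule arc_subset_connected)
      show "connected (cis ` {a'..b'})"
        by (intro connected_cis_image connected_Icc)
      show "cis (a u) \<in> cis ` {a'..b'}" "cis (b u) \<in> cis ` {a'..b'}"
        using ab'(2) S A B wA wB by metis+
      show "pt X \<in> circle - cis ` {a'..b'}"
        using ab'(2) S X pt(2) by (metis DiffI)
      show "pt X \<notin> cis ` {a u..b u}"
        using R_pt[OF X(1) u(1)] X(2) unfolding R_new[OF u(2)] by blast
    qed (use ab[rule_format, OF u(1)] in auto)
    moreover have "pt Y \<in> cis ` {a u..b u}"
      using R_pt[OF Y(1) u(1)] all[OF Y(1)] Y(2) unfolding R_new[OF u(2)] by blast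
    ultimately have "Y \<in> ?S"
      using ab'(2) Y(1) by blast
    then show False
      using Y(2) S[OF Y(1)] by blast
  qed
  have Int_conn: "connected (R u \<inter> R v)" if uv: "u \<in> V" "v \<in> V" for u v
  proof (cases "u \<in> V' \<and> v \<in> V'")
    case True
    then show ?thesis
      using predrawn_Int_connected R_old by simp
  next
    case False
    then have "R u \<union> R v \<noteq> circle"
      using no_cover[of u v] no_cover[of v u] uv by (auto simp: Un_commute)
    then show ?thesis
      using R_props uv by (intro connected_Int_if_Un_ne_circle) auto
  qed
  show thesis
  proof (rule that[of R])
    show "extends_rep V' R' R"
      by (simp add: extends_rep_def R_old)
    have "circular_arc_rep V E R"
      using R_arc meet_iff by (auto simp: circular_arc_rep_def)
    moreover have "normal_rep V R"
      using Int_conn by (simp add: normal_rep_def)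
    \<comment> \<open>Pairwise intersecting arcs belong to a clique, and the point of a maximal
      clique above it is common to all of them.\<close>
    moreover have "helly_rep V R"
      unfolding helly_rep_def
    proof (intro allI impI)
      fix S assume S: "S \<subseteq> V" "\<forall>u\<in>S. \<forall>v\<in>S. R u \<inter> R v \<noteq> {}"
      have "clique S E"
        unfolding clique_def using S meet_iff by (meson subsetD)
      then obtain C where C: "C \<in> M" "S \<subseteq> C"
        using clique_in_max_clique[OF graph S(1)] by blast
      have "pt C \<in> R v" if "v \<in> S" for v
        using R_pt[OF C(1), of v] that S(1) C(2) by blast
      then show "(\<Inter>v\<in>S. R v) \<noteq> {}"
        by blast
    qed
    ultimately show "nhca_rep V E R"
      by (simp add: nhca_rep_def)
  qed
qed

section \<open>From a representation to an order\<close>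

text \<open>Moves the origin of the clockwise angles from \<open>p\<close> to \<open>pt D\<close>.
  The two points lie in the connected set \<open>reg D\<close>, so the change can affect only
  cliques with the same region as \<open>D\<close>, and \<open>clique_prec\<close> does not compare
  these with cliques other than \<open>D\<close>.\<close>

lemma clique_prec_angle_less:
  assumes D: "D \<in> M" "connected (reg D)" and mid: "middle_point p (reg D)"
    and pt: "\<And>C. C \<in> M \<Longrightarrow> pt C \<in> reg C" "inj_on pt M"
    and q: "pt D = cis d"
    and prec: "(C, C') \<in> clique_prec V E V' R' D p"
  shows "Arg2pi (cis d / pt C) < Arg2pi (cis d / pt C')"
proof -
  have CM: "C \<in> M" "C' \<in> M"
    using prec by (auto simp: clique_prec_def)
  have ptc: "pt X \<in> circle" if "X \<in> M" for X
    using pt(1)[OF that] Reg_in_circle by blast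
  have cwd0: "cw d 0 = pt D"
    by (simp add: cw_def q)
  have angD: "Arg2pi (cis d / pt D) = 0"
    using angle_cw[of 0 d] cwd0 by simp
  have p: "p \<in> reg D"
    using mid by (simp add: middle_point_def)
  consider "C = D" "C' \<noteq> D"
    | "C \<noteq> D" "C' \<noteq> D" "\<forall>x\<in>reg C. \<forall>y\<in>reg C'. clockwise_less p x y"
    using prec by (auto simp: clique_prec_def)
  then show ?thesis
  proof cases
    case 1
    have "pt C' \<noteq> pt D"
      using inj_onD[OF pt(2)] CM D(1) 1 by blast
    then have "Arg2pi (cis d / pt C') \<noteq> 0"
      using cw_angle[OF ptc[OF CM(2)], of d] cwd0 by metis
    then show ?thesis
      using 1 angD angle_range(1)[of "cis d / pt C'"] by simp
  next
    case 2
    have less: "Arg2pi (p / x) < Arg2pi (p / y)" if "x \<in> reg C" "y \<in> reg C'" for x y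
      using 2(3) that by (simp add: clockwise_less_def)
    have "p \<noteq> 0"
      using subsetD[OF Reg_in_circle p] by auto
    then have pp: "Arg2pi (p / p) = 0"
      using Arg2pi_unique[of 1 0 1] by simp
    \<comment> \<open>Otherwise \<open>p\<close>, at angle \<open>0\<close>, would be a point of
      \<open>reg C'\<close>, and no point of \<open>reg C\<close> can come before it.\<close>
    have C'D: "reg C' \<noteq> reg D"
    proof
      assume "reg C' = reg D"
      then have "Arg2pi (p / pt C) < 0"
        using less[OF pt(1)[OF CM(1)], of p] p pp by simp
      then show False
        using angle_range(1)[of "p / pt C"] by simp
    qed
    have y: "pt C' \<notin> reg D"
      using C'D Reg_eq_if_meet[OF pt(1)[OF CM(2)]] by blast
    \<comment> \<open>Otherwise \<open>reg C\<close> contains points almost a full turn from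
      \<open>p\<close>, while \<open>pt C'\<close>, lying outside \<open>reg D\<close>, comes at
      least \<open>e\<close> before the end of the turn.\<close>
    have CD: "reg C \<noteq> reg D"
    proof
      assume eq: "reg C = reg D"
      have "pt C \<noteq> pt D"
        using inj_onD[OF pt(2)] CM D(1) 2 by blast
      moreover have "pt C \<in> reg D" "pt D \<in> reg D"
        using pt(1) CM D(1) eq by auto
      ultimately have "\<not> is_singleton (reg D)"
        by (auto elim!: is_singletonE)
      then obtain c e where e: "p = cis c" "e > 0" "e \<le> pi"
        "\<And>s. 0 < s \<Longrightarrow> s < e \<Longrightarrow> cw c (2 * pi - s) \<in> reg D"
        using middle_point_interior[OF mid] by metis
      define t where "t = Arg2pi (p / pt C')"
      have t: "cw c t = pt C'" "t < 2 * pi"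
        using cw_angle[OF ptc[OF CM(2)], of c] angle_range e(1) by (auto simp: t_def)
      have "\<not> 2 * pi - t < e"
        using e(4)[of "2 * pi - t"] t y by auto
      moreover have "cw c (2 * pi - e / 2) \<in> reg C"
        using e(4)[of "e / 2"] e(2) eq by simp
      then have "Arg2pi (p / cw c (2 * pi - e / 2)) < t"
        using less pt(1)[OF CM(2)] by (simp add: t_def)
      moreover have "Arg2pi (p / cw c (2 * pi - e / 2)) = 2 * pi - e / 2"
        unfolding e(1) using e(2,3) pi_gt_zero by (intro angle_cw) linarith+
      ultimately show False
        using e(2) by linarith
    qed
    have x: "pt C \<notin> reg D"
      using CD Reg_eq_if_meet[OF pt(1)[OF CM(1)]] by blast
    obtain c where c: "p = cis c"
      using ex_cis_in_window[OF subsetD[OF Reg_in_circle p]] by metis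
    define ang where "ang z = Arg2pi (cis c / z)" for z
    have ang: "0 \<le> ang z" "ang z < 2 * pi" for z
      using angle_range by (auto simp: ang_def)
    have cw: "cw c (ang z) = z" if "z \<in> circle" for z
      using cw_angle[OF that] by (simp add: ang_def)
    have xy: "ang (pt C) < ang (pt C')"
      using less[OF pt(1)[OF CM(1)] pt(1)[OF CM(2)]] by (simp add: ang_def c)
    have shift: "Arg2pi (cis d / z) = (if ang (pt D) \<le> ang z then ang z - ang (pt D)
      else ang z - ang (pt D) + 2 * pi)" (is "_ = ?t") if z: "z \<in> circle" for z
    proof -
      have "cis d / z = cis (c - ang (pt D)) / cis (c - ang z)"
        using cw[OF z] cw[OF ptc[OF D(1)]] q by (simp add: cw_def)
      also have "\<dots> = cis (ang z - ang (pt D))"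
        by (simp add: cis_divide)
      also have "\<dots> = cis ?t"
        by (simp flip: cis_mult)
      also have "\<dots> = cis 0 / cw 0 ?t"
        unfolding cw_def cis_divide by simp
      finally have "cis d / z = cis 0 / cw 0 ?t" .
      moreover have "Arg2pi (cis 0 / cw 0 ?t) = ?t"
        using ang(1)[of z] ang(2)[of z] ang(1)[of "pt D"] ang(2)[of "pt D"] by (intro angle_cw) auto
      ultimately show ?thesis
        by simp
    qed
    show ?thesis
    proof (rule ccontr)
      assume "\<not> ?thesis"
      \<comment> \<open>The change of origin reverses the order only if \<open>pt D\<close>
        separates the two points. The arc from \<open>pt C\<close> to \<open>pt C'\<close> would
        then contain \<open>pt D\<close> but not \<open>p\<close>, with both ends outside
        \<open>reg D\<close>.\<close>
      then have between: "ang (pt C) < ang (pt D)" "ang (pt D) \<le> ang (pt C')"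
        using xy ang(2)[of "pt C'"] ang(1)[of "pt C"]
        unfolding shift[OF ptc[OF CM(1)]] shift[OF ptc[OF CM(2)]] by (auto split: if_splits)
      let ?A = "cw c ` {ang (pt C)..ang (pt C')}"
      have "reg D \<subseteq> ?A \<or> reg D \<inter> ?A = {}"
        using xy D(2) Reg_in_circle x y cw ptc CM by (intro connected_avoiding_cw_ends) auto
      moreover have "pt D \<in> ?A"
        using between cw[OF ptc[OF D(1)]] by (intro image_eqI[of _ _ "ang (pt D)"]) auto
      moreover have "p \<notin> ?A"
      proof -
        have "cw c 0 = p"
          by (simp add: cw_def c)
        moreover from this have "ang (pt C) \<noteq> 0"
          using cw[OF ptc[OF CM(1)]] x p by metis
        then have "0 < ang (pt C)"
          using ang(1)[of "pt C"] by simp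
        ultimately show ?thesis
          using cw_mem_arc_iff[of 0 "ang (pt C)" "ang (pt C')" 0 c] ang by simp
      qed
      ultimately show False
        using p pt(1)[OF D(1)] by blast
    qed
  qed
qed

text \<open>The cliques are ordered by the clockwise angle of their points from \<open>pt D\<close>.
  Each required set consists of the cliques whose points lie in a connected set: an arc, an
  intersection of two arcs that is connected by normality, or a gap, which contains every region it
  meets.\<close>

lemma order_from_extension:
  assumes D: "D \<in> M" "connected (reg D)" "middle_point p (reg D)"
    and R: "nhca_rep V E R" "extends_rep V' R' R"
  obtains r where "linear_extension M (clique_prec V E V' R' D p) r"
    "\<forall>C\<in>M. \<forall>C'\<in>M. C \<noteq> C' \<and> reg C = reg C' \<longrightarrow> \<not> is_singleton (reg C)"
    "\<forall>v\<in>V. consecutive M (cyclic_order M r) (cliques_containing V E v)"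
    "\<forall>u w. universal_pair V E u w \<longrightarrow>
      consecutive M (cyclic_order M r) (cliques_containing V E u \<inter> cliques_containing V E w)"
    "\<forall>C\<in>M. \<forall>J\<in>gaps V' R' C. consecutive M (cyclic_order M r) (cliques_meeting V E V' R' J)"
proof -
  obtain pt where ptc: "\<And>C. C \<in> M \<Longrightarrow> pt C \<in> circle"
    and ptR: "\<And>C v. C \<in> M \<Longrightarrow> v \<in> V \<Longrightarrow> pt C \<in> R v \<longleftrightarrow> v \<in> C"
    by (rule ex_clique_points[OF R(1)]) blast
  have pt: "pt C \<in> reg C" if C: "C \<in> M" for C
  proof -
    have "v \<in> V' \<and> pt C \<in> R' v \<longleftrightarrow> v \<in> C \<inter> V'" for v
      using ptR[OF C, of v] R(2) V'_subset by (auto simp: extends_rep_def)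
    then show ?thesis
      using ptc[OF C] by (simp add: Reg_iff set_eq_iff)
  qed
  have inj: "inj_on pt M"
  proof (rule inj_onI)
    fix C C' assume C: "C \<in> M" "C' \<in> M" "pt C = pt C'"
    have "C \<subseteq> C'"
      using ptR[OF C(1)] ptR[OF C(2)] C(3) max_cliqueD(1)[OF C(1)] by auto
    then show "C = C'"
      using max_clique_subset_eq C by blast
  qed
  obtain d where d: "pt D = cis d"
    using ex_cis_in_window[OF ptc[OF D(1)]] by metis
  define ang where "ang C = Arg2pi (cis d / pt C)" for C
  have ang_inj: "C = C'" if "C \<in> M" "C' \<in> M" "ang C = ang C'" for C C'
    using inj_onD[OF inj _ that(1,2)] cw_angle_eq[of "pt C" "pt C'" d] ptc that by (simp add: ang_def)
  define r where "r = {(C, C') \<in> M \<times> M. ang C < ang C'}"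
  have r: "r = {(C, C') \<in> M \<times> M. Arg2pi (cis d / pt C) < Arg2pi (cis d / pt C')}"
    by (simp add: r_def ang_def)
  have cons: "consecutive M (cyclic_order M r) {C \<in> M. pt C \<in> A}" if "connected A" "A \<subseteq> circle" for A
    using consecutive_connected[OF _ that r] ptc by blast
  have arcs: "closed_arc (R v)" if "v \<in> V" for v
    using R(1) that by (auto simp: nhca_rep_def circular_arc_rep_def)
  have Rsub: "R v \<subseteq> circle" if "v \<in> V" for v
    using closed_arcD(1)[OF arcs[OF that]] .
  have containing: "cliques_containing V E v = {C \<in> M. pt C \<in> R v}" if "v \<in> V" for v
    unfolding cliques_containing_def using ptR that by blast
  show thesis
  proof (rule that[of r])
    show "linear_extension M (clique_prec V E V' R' D p) r"
      unfolding linear_extension_def strict_linear_order_on_def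
    proof (intro conjI)
      show "trans r" "irrefl r"
        by (auto simp: r_def trans_def irrefl_def)
      show "total_on M r"
      proof (rule total_onI)
        fix C C' assume C: "C \<in> M" "C' \<in> M" "C \<noteq> C'"
        then have "ang C < ang C' \<or> ang C' < ang C"
          using ang_inj linorder_neqE_linordered_idom by blast
        then show "(C, C') \<in> r \<or> (C', C) \<in> r"
          using C by (simp add: r_def)
      qed
      show "clique_prec V E V' R' D p \<subseteq> r"
      proof (rule subrelI)
        fix C C' assume prec: "(C, C') \<in> clique_prec V E V' R' D p"
        then have "C \<in> M" "C' \<in> M"
          by (auto simp: clique_prec_def)
        then show "(C, C') \<in> r"
          using clique_prec_angle_less[OF D(1,2,3) pt inj d prec] by (simp add: r)
      qed
    qed (auto simp: r_def)
    show "\<forall>C\<in>M. \<forall>C'\<in>M. C \<noteq> C' \<and> reg C = reg C' \<longrightarrow> \<not> is_singleton (reg C)"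
    proof (intro ballI impI notI)
      fix C C' assume C: "C \<in> M" "C' \<in> M" "C \<noteq> C' \<and> reg C = reg C'" "is_singleton (reg C)"
      then have "pt C = pt C'"
        using pt[OF C(1)] pt[OF C(2)] by (auto elim!: is_singletonE)
      then show False
        using inj_onD[OF inj _ C(1,2)] C(3) by blast
    qed
    show "\<forall>v\<in>V. consecutive M (cyclic_order M r) (cliques_containing V E v)"
      using containing cons closed_arcD(3)[OF arcs] Rsub by simp
    show "\<forall>u w. universal_pair V E u w \<longrightarrow>
      consecutive M (cyclic_order M r) (cliques_containing V E u \<inter> cliques_containing V E w)"
    proof (intro allI impI)
      fix u w assume "universal_pair V E u w"
      then have uw: "u \<in> V" "w \<in> V"
        by (auto simp: universal_pair_def)
      have "cliques_containing V E u \<inter> cliques_containing V E w = {C \<in> M. pt C \<in> R u \<inter> R w}"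
        using containing uw by auto
      moreover have "connected (R u \<inter> R w)"
        using R(1) uw connected_empty unfolding nhca_rep_def normal_rep_def by metis
      ultimately show "consecutive M (cyclic_order M r) (cliques_containing V E u \<inter> cliques_containing V E w)"
        using cons[of "R u \<inter> R w"] Rsub[OF uw(1)] by (simp add: le_infI1)
    qed
    show "\<forall>C\<in>M. \<forall>J\<in>gaps V' R' C. consecutive M (cyclic_order M r) (cliques_meeting V E V' R' J)"
    proof (intro ballI)
      fix C J assume J: "J \<in> gaps V' R' C"
      have "reg X \<inter> J \<noteq> {} \<longleftrightarrow> pt X \<in> J" if "X \<in> M" for X
        using Reg_subset_gap[OF J, of X] pt[OF that] by blast
      then have "cliques_meeting V E V' R' J = {X \<in> M. pt X \<in> J}"
        unfolding cliques_meeting_def by blast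
      then show "consecutive M (cyclic_order M r) (cliques_meeting V E V' R' J)"
        using cons[of J] gapsD[OF J] by simp
    qed
  qed
qed

end

theorem theorem7:
  fixes V V' :: "'a set" and E :: "'a set set"
    and R' :: "'a \<Rightarrow> complex set"
    and D :: "'a set" and p\<^sub>D :: complex
  assumes "simple_graph V E"
    and "\<not> (\<exists>v. universal_vertex V E v)"
    and "partial_nhca_rep V E V' R'"
    and "\<forall>C\<in>max_cliques V E. Reg V' R' C \<noteq> {}"
    and "D \<in> max_cliques V E"
    and "connected (Reg V' R' D)"
    and "middle_point p\<^sub>D (Reg V' R' D)"
  shows "(\<exists>R. nhca_rep V E R \<and> extends_rep V' R' R) \<longleftrightarrow>
    (\<exists>r. linear_extension (max_cliques V E) (clique_prec V E V' R' D p\<^sub>D) r \<and>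
       (\<forall>C\<in>max_cliques V E. \<forall>C'\<in>max_cliques V E.
          C \<noteq> C' \<and> Reg V' R' C = Reg V' R' C' \<longrightarrow> \<not> is_singleton (Reg V' R' C)) \<and>
       (\<forall>v\<in>V. consecutive (max_cliques V E) (cyclic_order (max_cliques V E) r)
          (cliques_containing V E v)) \<and>
       (\<forall>u w. universal_pair V E u w \<longrightarrow>
          consecutive (max_cliques V E) (cyclic_order (max_cliques V E) r)
            (cliques_containing V E u \<inter> cliques_containing V E w)) \<and>
       (\<forall>C\<in>max_cliques V E. \<forall>J\<in>gaps V' R' C.
          consecutive (max_cliques V E) (cyclic_order (max_cliques V E) r)
            (cliques_meeting V E V' R' J)))"
    (is "?ext \<longleftrightarrow> (\<exists>r. ?order r)")
proof -
  interpret partial_rep V V' E R'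
    using assms(1-4) by unfold_locales
  show ?thesis
  proof
    assume ?ext
    then obtain R where "nhca_rep V E R" "extends_rep V' R' R"
      by blast
    from order_from_extension[OF assms(5-7) this] show "\<exists>r. ?order r"
      by metis
  next
    assume "\<exists>r. ?order r"
    then obtain r where order: "?order r"
      by (elim exE)
    note r = order[THEN conjunct1] order[THEN conjunct2, THEN conjunct1]
      order[THEN conjunct2, THEN conjunct2, THEN conjunct1]
      order[THEN conjunct2, THEN conjunct2, THEN conjunct2, THEN conjunct1]
      order[THEN conjunct2, THEN conjunct2, THEN conjunct2, THEN conjunct2]
    have p: "p\<^sub>D \<in> Reg V' R' D"
      using assms(7) by (simp add: middle_point_def)
    \<comment> \<open>\<open>p\<^sub>D\<close> becomes the origin of the clockwise parameters, so
      \<open>clique_prec\<close> compares values of \<open>Arg2pi (cis c / x)\<close>.\<close>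
    then obtain c where c: "p\<^sub>D = cis c"
      using ex_cis_in_window[OF subsetD[OF Reg_in_circle p]] by metis
    obtain T where T: "\<forall>C\<in>M. cw c (T C) \<in> reg C" "inj_on T M"
      "r = {(C, C') \<in> M \<times> M. T C < T C'}" "\<forall>C\<in>M. \<forall>C'\<in>M. T C' - T C < 2 * pi"
      by (rule strict_placement[OF assms(5), of c r]) (use r p c in simp_all)
    show ?ext
      by (rule extension_from_placement[OF T r(3,4)]) blast
  qed
qed

end
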